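(* Let $\mathcal{T}$ be a tree on $k\geq 2$ vertices, and let $G_1,\dots,G_k$ be trees. Then the minimum of $\kappa(G)$ over all chains $G$ of $G_1,\dots,G_k$ with respect to $\mathcal{T}$ is attained by $G$ if and only if for each bridge $x\sim y\in\mathcal{B}_G$, $x$ and $y$ are centroids of $G_x$ and $G_y$, respectively, and for each $i\in\{1,\dots,k\}$ the set of vertices of $G_i$ that are incident to a bridge in $\mathcal{B}_G$ is a singleton.
   Context: All graphs are finite, simple and undirected. For a connected graph $H$ with $m_H$ edges, Kemeny's constant is that of the simple random walk on $H$ (from a vertex, move to a uniformly random neighbour): $\kappa(H)=\sum_{j\neq i}\pi_jm_{i,j}$, where $\pi_j=\deg_H(j)/(2m_H)$ is the stationary distribution and $m_{i,j}$ is the mean first passage time from $i$ to $j$; it does not depend on the choice of the vertex $i$. A vertex $v$ of a tree on $n$ vertices is a centroid if each connected component left after deleting $v$ contains at most $\lfloor n/2\rfloor$ vertices. Chain: let $\mathcal{T}$ be a tree with vertex set $\{1,\dots,k\}$ and $G_1,\dots,G_k$ connected graphs (on disjoint vertex sets). A chain of $G_1,\dots,G_k$ with respect to $\mathcal{T}$ is a graph $G$ obtained from the disjoint union of $G_1,\dots,G_k$ by choosing, for each edge $i\sim j$ of $\mathcal{T}$, some vertex $v_i\in V(G_i)$ and some vertex $v_j\in V(G_j)$ and adding the edge $v_i\sim v_j$ (the choices for different edges of $\mathcal{T}$ are independent; the same vertex may be chosen several times). $\mathcal{B}_G$ is the set of the $k-1$ added edges; each is a bridge of $G$. For a vertex $z$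 of $G$, $G_z$ denotes the graph $G_j$ with $z\in V(G_j)$. *)

theory Defs
  imports
    "HOL-Probability.Probability"
    "HOL-Library.Disjoint_Sets"
    "Graph_Theory.Digraph_Component"
begin

text \<open>
  Finite simple undirected graphs are the symmetric loop-free pair digraphs \<open>pair_graph\<close>: an
  undirected edge is a pair of opposite arcs, so a graph with \<open>m\<close> edges has \<open>2 * m\<close> arcs.

  The notion \<open>tree\<close> of the imported theory is not suited to this encoding: there the two arcs of a
  single edge already form a directed cycle. Undirected cycles are those with at least three arcs.
\<close>

definition undirected_tree :: "'a pair_pre_digraph \<Rightarrow> bool" where
  "undirected_tree G \<longleftrightarrow> pair_graph G \<and> Digraph_Component.connected (with_proj G) \<and>
     \<not> (\<exists>p. pre_digraph.cycle (with_proj G) p \<and> 3 \<le> length p)"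

text \<open>In a symmetric digraph the strongly connected components are the connected components.\<close>

definition centroid :: "'a pair_pre_digraph \<Rightarrow> 'a \<Rightarrow> bool" where
  "centroid G v \<longleftrightarrow> v \<in> pverts G \<and>
     (\<forall>C \<in> pre_digraph.sccs_verts (pre_digraph.del_vert (with_proj G) v).
        card C \<le> card (pverts G) div 2)"


section \<open>Random walk and Kemeny's constant\<close>

definition random_step :: "'a pair_pre_digraph \<Rightarrow> 'a \<Rightarrow> 'a pmf" where
  "random_step G v = pmf_of_set {w. (v, w) \<in> parcs G}"

text \<open>The law of the trajectory \<open>[X\<^sub>0, \<dots>, X\<^sub>t]\<close> of the simple random walk started at \<open>v\<close>.\<close>

primrec trajectory :: "'a pair_pre_digraph \<Rightarrow> nat \<Rightarrow> 'a \<Rightarrow> 'a list pmf" where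
  "trajectory G 0 v = return_pmf [v]"
| "trajectory G (Suc t) v =
     bind_pmf (random_step G v) (\<lambda>w. map_pmf (\<lambda>xs. v # xs) (trajectory G t w))"

definition first_passage_prob :: "'a pair_pre_digraph \<Rightarrow> 'a \<Rightarrow> 'a \<Rightarrow> nat \<Rightarrow> real" where
  "first_passage_prob G i j t =
     measure_pmf.prob (trajectory G t i) {xs. xs ! t = j \<and> (\<forall>s<t. xs ! s \<noteq> j)}"

text \<open>
  The expectation of the first passage time. On a finite connected graph the passage time is almost
  surely finite and the series converges.
\<close>

definition mean_first_passage_time :: "'a pair_pre_digraph \<Rightarrow> 'a \<Rightarrow> 'a \<Rightarrow> real" where
  "mean_first_passage_time G i j = (\<Sum>t. real t * first_passage_prob G i j t)"

definition stationary :: "'a pair_pre_digraph \<Rightarrow> 'a \<Rightarrow> real" where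
  "stationary G j = real (out_degree (with_proj G) j) / real (card (parcs G))"

text \<open>
  On a connected graph the sum does not depend on the starting vertex \<open>i\<close>, so an arbitrary one is
  picked.
\<close>

definition kemeny :: "'a pair_pre_digraph \<Rightarrow> real" where
  "kemeny G = (let i = (SOME i. i \<in> pverts G) in
     \<Sum>j \<in> pverts G - {i}. stationary G j * mean_first_passage_time G i j)"


section \<open>Chains of graphs\<close>

text \<open>
  For an edge \<open>i \<sim> j\<close> of \<open>T\<close>, the chosen end in \<open>Gs i\<close> of the added edge is \<open>c i j\<close> and the one in
  \<open>Gs j\<close> is \<open>c j i\<close>.
\<close>

definition attachment ::
  "nat pair_pre_digraph \<Rightarrow> (nat \<Rightarrow> 'a pair_pre_digraph) \<Rightarrow> (nat \<Rightarrow> nat \<Rightarrow> 'a) \<Rightarrow> bool" where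
  "attachment T Gs c \<longleftrightarrow> (\<forall>(i, j) \<in> parcs T. c i j \<in> pverts (Gs i))"

definition chain_graph ::
  "nat pair_pre_digraph \<Rightarrow> (nat \<Rightarrow> 'a pair_pre_digraph) \<Rightarrow> (nat \<Rightarrow> nat \<Rightarrow> 'a) \<Rightarrow> 'a pair_pre_digraph"
where
  "chain_graph T Gs c = \<lparr>
     pverts = (\<Union>i \<in> pverts T. pverts (Gs i)),
     parcs = (\<Union>i \<in> pverts T. parcs (Gs i)) \<union> (\<lambda>(i, j). (c i j, c j i)) ` parcs T \<rparr>"

definition is_chain ::
  "nat pair_pre_digraph \<Rightarrow> (nat \<Rightarrow> 'a pair_pre_digraph) \<Rightarrow> 'a pair_pre_digraph \<Rightarrow> bool" where
  "is_chain T Gs G \<longleftrightarrow> (\<exists>c. attachment T Gs c \<and> G = chain_graph T Gs c)"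

text \<open>
  The added edges, each as a pair of opposite arcs. As the parts are disjoint, these are exactly
  the arcs of the chain \<open>G\<close> that belong to no part.
\<close>

definition bridges ::
  "nat pair_pre_digraph \<Rightarrow> (nat \<Rightarrow> 'a pair_pre_digraph) \<Rightarrow> 'a pair_pre_digraph \<Rightarrow> 'a rel" where
  "bridges T Gs G = parcs G - (\<Union>i \<in> pverts T. parcs (Gs i))"

definition part_of ::
  "nat pair_pre_digraph \<Rightarrow> (nat \<Rightarrow> 'a pair_pre_digraph) \<Rightarrow> 'a \<Rightarrow> 'a pair_pre_digraph" where
  "part_of T Gs z = Gs (THE i. i \<in> pverts T \<and> z \<in> pverts (Gs i))"

end

theory Submission
  imports Defs
begin

text \<open>
  In a tree on \<open>n\<close> vertices, with distance \<open>d\<close> and \<open>D v = (\<Sum>x. d v x)\<close>, the mean first passage time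
  from \<open>i\<close> to \<open>j\<close> is \<open>(n - 1) * d i j + D j - D i\<close>. Hence Kemeny's constant is an increasing affine
  function of \<open>\<Sum>v. D v\<close>, twice the Wiener index. In a chain this sum splits into a constant and one
  term per part, obtained by projecting all vertices to that part. The term of \<open>Gs i\<close> is a constant
  plus the \<open>D\<close>-values, within \<open>Gs i\<close>, of the bridge ends and the distances between these ends, with
  positive weights that depend only on the sizes of the parts. It is least iff all bridge ends in
  \<open>Gs i\<close> coincide and minimise \<open>D\<close>, and the minimisers of \<open>D\<close> are the centroids because \<open>D\<close> is
  strictly convex along paths.
\<close>

section \<open>Tree distances\<close>

text \<open>
  Axiomatises the graph distance of a finite tree by one property: among the neighbours of a vertex
  exactly one is closer to a given other vertex and the rest are farther. For a chain this is
  checked on an explicit formula for the distance, so that cycles of the chain need no analysis.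
\<close>

locale tree_metric =
  fixes V :: "'a set" and A :: "'a rel" and d :: "'a \<Rightarrow> 'a \<Rightarrow> nat"
  assumes finite_verts: "finite V"
    and verts_nonempty: "V \<noteq> {}"
    and arcs_subset: "A \<subseteq> V \<times> V"
    and arcs_sym: "(v, w) \<in> A \<Longrightarrow> (w, v) \<in> A"
    and arcs_irrefl: "(v, v) \<notin> A"
    and dist_self: "v \<in> V \<Longrightarrow> d v v = 0"
    and dist_commute: "v \<in> V \<Longrightarrow> w \<in> V \<Longrightarrow> d v w = d w v"
    and closer_neighbour: "v \<in> V \<Longrightarrow> x \<in> V \<Longrightarrow> v \<noteq> x \<Longrightarrow>
      \<exists>w. (v, w) \<in> A \<and> d w x + 1 = d v x \<and> (\<forall>w'. (v, w') \<in> A \<and> w' \<noteq> w \<longrightarrow> d w' x = d v x + 1)"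
begin

definition neighbours :: "'a \<Rightarrow> 'a set" where
  "neighbours v = {w. (v, w) \<in> A}"

text \<open>The next vertex on the path from \<open>v\<close> to \<open>x\<close>; unspecified for
  \<open>v = x\<close>.\<close>

definition hop :: "'a \<Rightarrow> 'a \<Rightarrow> 'a" where
  "hop v x = (THE w. (v, w) \<in> A \<and> d w x + 1 = d v x)"

lemma arc_verts: "(v, w) \<in> A \<Longrightarrow> v \<in> V \<and> w \<in> V"
  using arcs_subset by auto

lemma neighbours_subset: "neighbours v \<subseteq> V"
  using arc_verts by (auto simp: neighbours_def)

lemma finite_neighbours [simp]: "finite (neighbours v)"
  using neighbours_subset finite_verts by (rule finite_subset)

lemma
  assumes "v \<in> V" "x \<in> V" "v \<noteq> x"
  shows hop_arc: "(v, hop v x) \<in> A"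
    and dist_hop: "d (hop v x) x + 1 = d v x"
    and dist_not_hop: "(v, w) \<in> A \<Longrightarrow> w \<noteq> hop v x \<Longrightarrow> d w x = d v x + 1"
proof -
  obtain w0 where w0: "(v, w0) \<in> A" "d w0 x + 1 = d v x"
    "\<And>w'. (v, w') \<in> A \<Longrightarrow> w' \<noteq> w0 \<Longrightarrow> d w' x = d v x + 1"
    using closer_neighbour[OF assms] by blast
  have "hop v x = w0"
    unfolding hop_def
  proof (rule the_equality)
    fix w assume w: "(v, w) \<in> A \<and> d w x + 1 = d v x"
    show "w = w0"
    proof (rule ccontr)
      assume "w \<noteq> w0"
      then have "d w x = d v x + 1" using w0(3) w by blast
      then show False using w by simp
    qed
  qed (use w0 in simp)
  with w0 show "(v, hop v x) \<in> A" "d (hop v x) x + 1 = d v x"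
    "(v, w) \<in> A \<Longrightarrow> w \<noteq> hop v x \<Longrightarrow> d w x = d v x + 1"
    by auto
qed

lemma hop_eqI:
  assumes "(v, w) \<in> A" "x \<in> V" "v \<noteq> x" "d w x < d v x"
  shows "hop v x = w"
  using dist_not_hop[of v x w] arc_verts[OF assms(1)] assms by fastforce

lemma hop_in_verts: "v \<in> V \<Longrightarrow> x \<in> V \<Longrightarrow> v \<noteq> x \<Longrightarrow> hop v x \<in> V"
  using hop_arc arc_verts by blast

lemma dist_pos: "v \<in> V \<Longrightarrow> x \<in> V \<Longrightarrow> v \<noteq> x \<Longrightarrow> 0 < d v x"
  using dist_hop[of v x] by linarith

lemma dist_eq_0_iff: "v \<in> V \<Longrightarrow> x \<in> V \<Longrightarrow> d v x = 0 \<longleftrightarrow> v = x"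
  using dist_pos dist_self by fastforce

lemma dist_adjacent:
  assumes "(v, w) \<in> A" shows "d v w = 1"
proof -
  have "v \<noteq> w" "v \<in> V" "w \<in> V" using assms arcs_irrefl arc_verts by auto
  then show ?thesis
    using dist_hop[of v w] dist_not_hop[of v w w] assms dist_self[of w] by fastforce
qed

lemma hop_adjacent: "(v, w) \<in> A \<Longrightarrow> hop v w = w"
  using hop_eqI[of v w w] arc_verts[of v w] arcs_irrefl[of w] dist_self[of w] dist_adjacent[of v w]
  by fastforce

lemma dist_arc_cases:
  assumes "(v, w) \<in> A" "x \<in> V"
  shows "d w x = d v x + 1 \<or> d v x = d w x + 1"
proof (cases "v = x")
  case True
  then show ?thesis
    using assms dist_adjacent arcs_sym dist_self by force
next
  case False
  then show ?thesis
    using dist_hop[of v x] dist_not_hop[of v x w] arc_verts[OF assms(1)] assms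
    by (cases "w = hop v x") simp_all
qed

lemma dist_arc_le: "(v, w) \<in> A \<Longrightarrow> x \<in> V \<Longrightarrow> d w x \<le> d v x + 1"
  using dist_arc_cases by fastforce

text \<open>With \<open>w = hop v a\<close>, the step \<open>e\<close> from \<open>a\<close> towards
  \<open>w\<close> is closer to \<open>v\<close> than \<open>a\<close> is, and so is
  \<open>b\<close>; hence \<open>e = b\<close> by uniqueness of the closer neighbour. Then
  \<open>w\<close> is closer to \<open>b\<close> than \<open>v\<close> is, which makes it
  \<open>hop v b\<close>.\<close>

lemma hop_arc_cong_aux:
  assumes ab: "(a, b) \<in> A" and v: "v \<in> V" "a \<noteq> v" "b \<noteq> v" and less: "d b v < d a v"
  shows "hop v a = hop v b"
proof -
  define w where "w = hop v a"
  have V: "a \<in> V" "b \<in> V" using ab arc_verts by auto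
  have w: "(v, w) \<in> A" "d w a + 1 = d v a"
    using hop_arc[of v a] dist_hop[of v a] V v by (auto simp: w_def)
  have wV: "w \<in> V" using w arc_verts by blast
  have dab: "d a v = d b v + 1" using dist_arc_cases[OF ab v(1)] less by auto
  have "a \<noteq> w"
  proof
    assume "a = w"
    then have "d v a = 1" using w dist_self wV by simp
    then have "d b v = 0" using dab dist_commute V v by simp
    then show False using dist_pos V v by fastforce
  qed
  define e where "e = hop a w"
  have e: "(a, e) \<in> A" "d e w + 1 = d a w"
    using hop_arc[of a w] dist_hop[of a w] V wV \<open>a \<noteq> w\<close> by (auto simp: e_def)
  have eV: "e \<in> V" using e arc_verts by blast
  have "d e v = d v e" "d w e = d e w" "d w a = d a w" "d v a = d a v"
    using dist_commute V eV wV v by auto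
  moreover have "d v e \<le> d w e + 1" using dist_arc_le[OF arcs_sym[OF w(1)] eV] .
  ultimately have "d e v < d a v" using e w by linarith
  then have "e = b"
    using hop_eqI[OF e(1) v(1,2)] hop_eqI[OF ab v(1,2) less] by simp
  then have "d w b < d v b"
    using e w dab dist_commute V eV wV v by simp
  then show ?thesis using hop_eqI[OF w(1) V(2)] v by (simp add: w_def)
qed

lemma hop_arc_cong:
  assumes "(a, b) \<in> A" "v \<in> V" "a \<noteq> v" "b \<noteq> v"
  shows "hop v a = hop v b"
proof -
  consider "d b v < d a v" | "d a v < d b v"
    using dist_arc_cases[OF assms(1,2)] by fastforce
  then show ?thesis
  proof cases
    case 1
    then show ?thesis using hop_arc_cong_aux assms by simp
  next
    case 2
    then show ?thesis using hop_arc_cong_aux[OF arcs_sym] assms by simp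
  qed
qed

section \<open>Sums of distances over neighbours and arcs\<close>

lemma sum_neighbours_dist:
  fixes g :: "nat \<Rightarrow> real"
  assumes "v \<in> V" "x \<in> V" "v \<noteq> x"
  shows "(\<Sum>w\<in>neighbours v. g (d w x)) =
    real (card (neighbours v)) * g (d v x + 1) + g (d v x - 1) - g (d v x + 1)"
proof -
  have h: "hop v x \<in> neighbours v" using hop_arc[OF assms] by (simp add: neighbours_def)
  have "(\<Sum>w\<in>neighbours v. g (d w x)) =
      g (d (hop v x) x) + (\<Sum>w\<in>neighbours v - {hop v x}. g (d w x))"
    using h by (simp add: sum.remove)
  also have "(\<Sum>w\<in>neighbours v - {hop v x}. g (d w x)) =
      (\<Sum>w\<in>neighbours v - {hop v x}. g (d v x + 1))"
    by (intro sum.cong refl arg_cong[where f = g] dist_not_hop[OF assms])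
      (auto simp: neighbours_def)
  also have "\<dots> = (real (card (neighbours v)) - 1) * g (d v x + 1)"
    using h card_gt_0_iff[of "neighbours v"] by (force simp: card_Diff_singleton of_nat_diff)
  also have "d (hop v x) x = d v x - 1" using dist_hop[OF assms] by simp
  finally show ?thesis by (simp add: algebra_simps)
qed

lemma sum_neighbours_dist_self:
  fixes g :: "nat \<Rightarrow> real"
  shows "(\<Sum>w\<in>neighbours v. g (d w v)) = real (card (neighbours v)) * g 1"
  by (simp add: neighbours_def dist_adjacent arcs_sym)

lemma neighbours_nonempty:
  assumes "2 \<le> card V" "v \<in> V"
  shows "neighbours v \<noteq> {}"
proof -
  have "V \<noteq> {v}" using assms by auto
  then obtain x where "x \<in> V" "v \<noteq> x" using assms by blast
  then show ?thesis using hop_arc assms by (auto simp: neighbours_def)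
qed

text \<open>Double counting of the arcs: by symmetry, each vertex occurs as a neighbour once per arc
  leaving it.\<close>

lemma sum_over_arcs_swap:
  fixes g :: "'a \<Rightarrow> real"
  shows "(\<Sum>v\<in>V. \<Sum>w\<in>neighbours v. g w) = (\<Sum>v\<in>V. real (card (neighbours v)) * g v)"
proof -
  have "(\<Sum>v\<in>V. \<Sum>w\<in>neighbours v. g w) = (\<Sum>v\<in>V. \<Sum>w\<in>V. if (v, w) \<in> A then g w else 0)"
    by (intro sum.cong refl sum.mono_neutral_cong_left)
      (use finite_verts neighbours_subset in \<open>auto simp: neighbours_def\<close>)
  also have "\<dots> = (\<Sum>w\<in>V. \<Sum>v\<in>V. if (v, w) \<in> A then g w else 0)"
    by (rule sum.swap)
  also have "\<dots> = (\<Sum>w\<in>V. \<Sum>v\<in>neighbours w. g w)"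
    by (intro sum.cong refl sum.mono_neutral_cong_right)
      (use finite_verts neighbours_subset arcs_sym in \<open>auto simp: neighbours_def\<close>)
  finally show ?thesis by simp
qed

definition total_dist :: "'a \<Rightarrow> real" where
  "total_dist v = (\<Sum>x\<in>V. real (d v x))"

definition deg :: "'a \<Rightarrow> real" where
  "deg v = real (card (neighbours v))"

lemma total_dist_alt: "v \<in> V \<Longrightarrow> total_dist v = (\<Sum>x\<in>V. real (d x v))"
  unfolding total_dist_def by (intro sum.cong) (auto simp: dist_commute)

text \<open>The \<open>-2\<close> accounts for the single closer neighbour; there is none at
  \<open>v = x\<close>, where the conditional restores it.\<close>

lemma sum_neighbours_dist_real:
  assumes "v \<in> V" "x \<in> V"
  shows "(\<Sum>w\<in>neighbours v. real (d w x)) =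
    deg v * d v x + deg v - 2 + (if v = x then 2 else 0)"
proof (cases "v = x")
  case True
  then show ?thesis
    using sum_neighbours_dist_self[of real v] assms by (simp add: deg_def dist_self)
next
  case False
  then show ?thesis
    using sum_neighbours_dist[OF assms False, of real] dist_pos[OF assms False]
    by (simp add: deg_def of_nat_diff algebra_simps)
qed

text \<open>One neighbour lies at distance \<open>d v x - 1\<close> instead of
  \<open>d v x + 1\<close>, and the squares differ by \<open>4 * d v x\<close>. This vanishes at
  \<open>v = x\<close>, so the formula is uniform, unlike in the linear case.\<close>

lemma sum_neighbours_dist_square:
  assumes "v \<in> V" "x \<in> V"
  shows "(\<Sum>w\<in>neighbours v. real (d w x)^2) = deg v * (d v x + 1)^2 - 4 * d v x"
proof (cases "v = x")
  case True
  then show ?thesis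
    using sum_neighbours_dist_self[of "\<lambda>k. (real k)^2" v] assms
    by (simp add: deg_def dist_self)
next
  case False
  then show ?thesis
    using sum_neighbours_dist[OF assms False, of "\<lambda>k. (real k)^2"] dist_pos[OF assms False]
    by (simp add: deg_def of_nat_diff algebra_simps power2_eq_square)
qed

lemma sum_neighbours_total_dist:
  assumes "v \<in> V"
  shows "(\<Sum>w\<in>neighbours v. total_dist w) =
    deg v * total_dist v + card V * (deg v - 2) + 2"
proof -
  have "(\<Sum>w\<in>neighbours v. total_dist w) = (\<Sum>x\<in>V. \<Sum>w\<in>neighbours v. real (d w x))"
    unfolding total_dist_def by (rule sum.swap)
  also have "\<dots> = (\<Sum>x\<in>V. deg v * d v x + (deg v - 2) + (if v = x then 2 else 0))"
    by (intro sum.cong refl) (simp add: sum_neighbours_dist_real assms)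
  also have "\<dots> = deg v * total_dist v + card V * (deg v - 2) + 2"
    using finite_verts assms
    by (simp add: sum.distrib total_dist_def sum_distrib_left)
  finally show ?thesis .
qed

text \<open>Summing the distance to a fixed \<open>x\<close> over all arcs in two ways cancels
  \<open>deg v * d v x\<close> and leaves the sum of the degrees. It encodes that a tree has
  \<open>card V - 1\<close> edges.\<close>

lemma sum_deg: "(\<Sum>v\<in>V. deg v) = 2 * real (card V) - 2"
proof -
  obtain x where x: "x \<in> V" using verts_nonempty by auto
  have "(\<Sum>v\<in>V. deg v * d v x) =
      (\<Sum>v\<in>V. deg v * d v x + deg v - 2 + (if v = x then 2 else 0))"
    unfolding deg_def
    by (subst sum_over_arcs_swap[symmetric], intro sum.cong refl)
      (simp add: sum_neighbours_dist_real x deg_def)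
  also have "\<dots> = (\<Sum>v\<in>V. deg v * d v x) + (\<Sum>v\<in>V. deg v) - 2 * card V + 2"
    using finite_verts x by (simp add: sum.distrib sum_subtractf)
  finally show ?thesis by simp
qed

text \<open>Summing squared distances over the arcs in both ways leaves a linear relation, because the
  quadratic terms cancel.\<close>

lemma sum_deg_dist:
  assumes "x \<in> V"
  shows "(\<Sum>v\<in>V. deg v * d v x) = 2 * total_dist x - (real (card V) - 1)"
proof -
  have "(\<Sum>v\<in>V. deg v * (real (d v x))^2) =
      (\<Sum>v\<in>V. deg v * (d v x + 1)^2 - 4 * d v x)"
    unfolding deg_def
    by (subst sum_over_arcs_swap[symmetric], intro sum.cong refl)
      (simp add: sum_neighbours_dist_square assms deg_def)
  also have "\<dots> = (\<Sum>v\<in>V. deg v * (real (d v x))^2 + 2 * (deg v * d v x) + deg v - 4 * d v x)"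
    by (intro sum.cong refl) (simp add: algebra_simps power2_eq_square)
  also have "\<dots> = (\<Sum>v\<in>V. deg v * (real (d v x))^2) + 2 * (\<Sum>v\<in>V. deg v * d v x)
      + (\<Sum>v\<in>V. deg v) - 4 * total_dist x"
    using assms by (simp add: sum.distrib sum_subtractf sum_distrib_left total_dist_alt)
  finally show ?thesis by (simp add: sum_deg)
qed

section \<open>Convexity of the total distance and its minimisers\<close>

lemma total_dist_neighbours_convex:
  assumes "(y, a) \<in> A" "(y, b) \<in> A" "a \<noteq> b"
  shows "2 * total_dist y < total_dist a + total_dist b"
proof -
  have V: "y \<in> V" using assms arc_verts by blast
  have "2 * total_dist y = (\<Sum>x\<in>V. 2 * real (d y x))"
    by (simp add: total_dist_def sum_distrib_left)
  \<comment> \<open>At most one of \<open>a\<close>, \<open>b\<close> is closer to \<open>x\<close>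
    than \<open>y\<close> is; the term \<open>x = y\<close> makes the inequality strict.\<close>
  also have "\<dots> < (\<Sum>x\<in>V. real (d a x) + real (d b x))"
  proof (rule sum_strict_mono_strong[OF finite_verts V])
    show "2 * real (d y y) < real (d a y) + real (d b y)"
      using assms dist_adjacent arcs_sym V dist_self by simp
    fix x assume x: "x \<in> V"
    show "2 * real (d y x) \<le> real (d a x) + real (d b x)"
    proof (cases "y = x")
      case True then show ?thesis using V dist_self by simp
    next
      case False
      then show ?thesis
        using dist_hop[OF V x] dist_not_hop[OF V x, of a] dist_not_hop[OF V x, of b] assms
        by (cases "a = hop y x"; cases "b = hop y x") auto
    qed
  qed
  finally show ?thesis by (simp add: total_dist_def sum.distrib)
qed

text \<open>For consecutive vertices \<open>x\<close>, \<open>p\<close>, \<open>q\<close> on the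
  path to \<open>v\<close>, strict convexity at \<open>p\<close> carries the inequality between
  \<open>q\<close> and \<open>p\<close> over to \<open>p\<close> and \<open>x\<close>. Minimality of
  \<open>v\<close> among its neighbours starts the induction.\<close>

lemma total_dist_hop_le:
  assumes v: "v \<in> V" and min: "\<And>w. (v, w) \<in> A \<Longrightarrow> total_dist v \<le> total_dist w"
    and "x \<in> V" "x \<noteq> v"
  shows "total_dist (hop x v) \<le> total_dist x"
  using assms(3,4)
proof (induction "d x v" arbitrary: x rule: less_induct)
  case less
  define p where "p = hop x v"
  have p: "(x, p) \<in> A" "d p v + 1 = d x v" "p \<in> V"
    using hop_arc[OF less(2) v less(3)] dist_hop[OF less(2) v less(3)] arc_verts
    by (auto simp: p_def)
  show ?case
  proof (cases "p = v")
    case True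
    then show ?thesis using min[OF arcs_sym[OF p(1)[unfolded True]]] p_def by simp
  next
    case False
    define q where "q = hop p v"
    have q: "(p, q) \<in> A" "d q v + 1 = d p v"
      using hop_arc[OF p(3) v False] dist_hop[OF p(3) v False] by (auto simp: q_def)
    have "q \<noteq> x" using q p by auto
    then have "2 * total_dist p < total_dist q + total_dist x"
      using total_dist_neighbours_convex[OF q(1) arcs_sym[OF p(1)]] by simp
    moreover have "total_dist q \<le> total_dist p"
      using less(1)[of p] p False q_def by simp
    ultimately show ?thesis by (simp add: p_def)
  qed
qed

lemma total_dist_local_min_is_global:
  assumes v: "v \<in> V" and min: "\<And>w. (v, w) \<in> A \<Longrightarrow> total_dist v \<le> total_dist w"
    and "x \<in> V"
  shows "total_dist v \<le> total_dist x"
  using assms(3)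
proof (induction "d x v" arbitrary: x rule: less_induct)
  case less
  show ?case
  proof (cases "x = v")
    case False
    then show ?thesis
      using less(1)[of "hop x v"] dist_hop[OF less(2) v False] hop_in_verts[OF less(2) v False]
        total_dist_hop_le[OF v min less(2) False] by linarith
  qed simp
qed

text \<open>For an arc \<open>(v, w)\<close>, the component of \<open>w\<close> after deleting
  \<open>v\<close>, expressed by distances so that its size can be read off from
  \<open>total_dist\<close>.\<close>

definition branch :: "'a \<Rightarrow> 'a \<Rightarrow> 'a set" where
  "branch v w = {x \<in> V. d w x < d v x}"

text \<open>Passing from \<open>v\<close> to \<open>w\<close> brings the vertices of
  \<open>branch v w\<close> one step closer and takes all others one step away.\<close>

lemma total_dist_adjacent:
  assumes "(v, w) \<in> A"
  shows "total_dist w = total_dist v + real (card V) - 2 * real (card (branch v w))"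
proof -
  have "total_dist w = (\<Sum>x\<in>V. real (d v x) + 1 - (if x \<in> branch v w then 2 else 0))"
    unfolding total_dist_def
    by (intro sum.cong refl) (use dist_arc_cases[OF assms] in \<open>fastforce simp: branch_def\<close>)
  also have "\<dots> = total_dist v + card V - (\<Sum>x\<in>V. if x \<in> branch v w then 2 else 0)"
    by (simp add: sum_subtractf sum.distrib total_dist_def)
  also have "(\<Sum>x\<in>V. if x \<in> branch v w then 2 else (0::real)) = (\<Sum>x\<in>branch v w. 2)"
    by (rule sum.mono_neutral_cong_right) (use finite_verts in \<open>auto simp: branch_def\<close>)
  finally show ?thesis by simp
qed

text \<open>A local minimum is global by convexity, and by \<open>total_dist_adjacent\<close> the
  comparison with a neighbour \<open>w\<close> says
  \<open>2 * card (branch v w) \<le> card V\<close>.\<close>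

lemma total_dist_minimal_iff_branches:
  assumes "v \<in> V"
  shows "(\<forall>x\<in>V. total_dist v \<le> total_dist x) \<longleftrightarrow>
    (\<forall>w. (v, w) \<in> A \<longrightarrow> card (branch v w) \<le> card V div 2)"
proof -
  have "(\<forall>x\<in>V. total_dist v \<le> total_dist x) \<longleftrightarrow>
      (\<forall>w. (v, w) \<in> A \<longrightarrow> total_dist v \<le> total_dist w)"
    using total_dist_local_min_is_global[OF assms] arc_verts by blast
  also have "\<dots> \<longleftrightarrow> (\<forall>w. (v, w) \<in> A \<longrightarrow> card (branch v w) \<le> card V div 2)"
  proof -
    have "total_dist v \<le> total_dist w \<longleftrightarrow> card (branch v w) \<le> card V div 2" if "(v, w) \<in> A" for w
      unfolding total_dist_adjacent[OF that] by linarith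
    then show ?thesis by blast
  qed
  finally show ?thesis .
qed

lemma mem_branch_iff:
  "(v, w) \<in> A \<Longrightarrow> x \<in> branch v w \<longleftrightarrow> x \<in> V - {v} \<and> hop v x = w"
  using hop_eqI[of v w x] dist_hop[of v x] arc_verts[of v w] dist_self[of v]
  by (cases "x = v") (auto simp: branch_def)

text \<open>Seen from \<open>v\<close>, both ends of an arc off \<open>v\<close> have the same first
  step. Hence walks avoiding \<open>v\<close> never leave a branch.\<close>

lemma arc_in_branch:
  assumes "(v, w) \<in> A" "(a, b) \<in> A" "b \<noteq> v" "a \<in> branch v w"
  shows "b \<in> branch v w"
  using assms mem_branch_iff[OF assms(1)] hop_arc_cong[of a b v] arc_verts[OF assms(1)] arc_verts[OF assms(2)]
  by simp

end

section \<open>First passage times and Kemeny's constant of a tree\<close>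

definition stopped_step :: "('a \<Rightarrow> 'a set) \<Rightarrow> 'a \<Rightarrow> ('a \<Rightarrow> real) \<Rightarrow> 'a \<Rightarrow> real" where
  "stopped_step N j g v = (if v = j then 0 else (\<Sum>w\<in>N v. g w) / card (N v))"

text \<open>With \<open>P\<close> the step of the walk killed at \<open>j\<close> and \<open>1\<^sub>j\<close> the indicator of the complement of
  \<open>j\<close>, the equation \<open>f = 1\<^sub>j + P f\<close> unfolds to \<open>f = 1\<^sub>j + \<dots> + P\<^sup>n 1\<^sub>j + P\<^sup>n\<^sup>+\<^sup>1 f\<close>. Since \<open>f\<close> is at least
  \<open>1\<close> off \<open>j\<close> and bounded, \<open>P f \<le> r f\<close> for some \<open>r < 1\<close>, so that the remainder decays
  geometrically.\<close>

lemma hitting_time_sums: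
  fixes f :: "'a \<Rightarrow> real" and q :: "nat \<Rightarrow> 'a \<Rightarrow> real"
  assumes V: "finite V"
    and N: "\<And>v. v \<in> V \<Longrightarrow> N v \<subseteq> V" "\<And>v. v \<in> V \<Longrightarrow> N v \<noteq> {}"
    and q0: "\<And>v. v \<in> V \<Longrightarrow> q 0 v = (if v = j then 1 else 0)"
    and qS: "\<And>t v. v \<in> V \<Longrightarrow> q (Suc t) v = stopped_step N j (q t) v"
    and f0: "\<And>v. v \<in> V \<Longrightarrow> 0 \<le> f v"
    and fj: "f j = 0"
    and fS: "\<And>v. v \<in> V \<Longrightarrow> v \<noteq> j \<Longrightarrow> f v = 1 + (\<Sum>w\<in>N v. f w) / card (N v)"
    and i: "i \<in> V"
  shows "(\<lambda>t. real t * q t i) sums f i"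
proof -
  let ?P = "stopped_step N j"
  \<comment> \<open>For the walk, \<open>Q t v\<close> is the probability of avoiding
    \<open>j\<close> up to time \<open>t\<close>; \<open>F t\<close> is the remainder after
    \<open>t\<close> expansions of \<open>f\<close>.\<close>
  define Q where "Q t = (?P ^^ t) (\<lambda>v. if v = j then 0 else 1)" for t
  define F where "F t = (?P ^^ t) f" for t
  have QS: "Q (Suc t) = ?P (Q t)" and FS: "F (Suc t) = ?P (F t)" for t
    by (simp_all add: Q_def F_def)
  have card_pos: "0 < card (N v)" if "v \<in> V" for v
    using N[OF that] finite_subset[OF _ V] by (simp add: card_gt_0_iff)
  have P_mono: "?P g v \<le> ?P h v" if "v \<in> V" "\<And>w. w \<in> V \<Longrightarrow> g w \<le> h w" for g h v
    using that N(1)[of v] by (auto simp: stopped_step_def intro!: divide_right_mono sum_mono)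
  have P_cong: "?P g v = ?P h v" if "v \<in> V" "\<And>w. w \<in> V \<Longrightarrow> g w = h w" for g h v
    using P_mono[of v g h] P_mono[of v h g] that by simp
  have P_add: "?P (\<lambda>w. g w + h w) v = ?P g v + ?P h v" for g h v
    by (simp add: stopped_step_def sum.distrib add_divide_distrib)
  have P_scale: "?P (\<lambda>w. c * g w) v = c * ?P g v" for c g v
    by (simp add: stopped_step_def sum_distrib_left)
  \<comment> \<open>Avoidance up to time \<open>t\<close> splits into first passage at time
    \<open>t + 1\<close> and avoidance up to time \<open>t + 1\<close>.\<close>
  have qQ: "q (Suc t) v + Q (Suc t) v = Q t v" if "v \<in> V" for t v
    using that
  proof (induction t arbitrary: v)
    case 0
    have "q (Suc 0) v + Q (Suc 0) v = ?P (\<lambda>w. q 0 w + Q 0 w) v"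
      using 0 by (simp add: qS QS P_add)
    also have "\<dots> = ?P (\<lambda>_. 1) v"
      by (rule P_cong[OF 0]) (simp add: q0 Q_def)
    also have "\<dots> = Q 0 v" using card_pos[OF 0] by (simp add: stopped_step_def Q_def)
    finally show ?case .
  next
    case (Suc t)
    have "q (Suc (Suc t)) v + Q (Suc (Suc t)) v = ?P (\<lambda>w. q (Suc t) w + Q (Suc t) w) v"
      using Suc.prems by (simp add: qS QS P_add)
    also have "\<dots> = ?P (Q t) v" using Suc by (intro P_cong) auto
    finally show ?case by (simp add: QS)
  qed
  have QF: "Q t v + F (Suc t) v = F t v" if "v \<in> V" for t v
    using that
  proof (induction t arbitrary: v)
    case 0
    then show ?case using fS[OF 0] fj by (simp add: Q_def F_def stopped_step_def)
  next
    case (Suc t)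
    have "Q (Suc t) v + F (Suc (Suc t)) v = ?P (\<lambda>w. Q t w + F (Suc t) w) v"
      by (simp add: QS FS[of "Suc t"] P_add)
    also have "\<dots> = ?P (F t) v" using Suc by (intro P_cong) auto
    finally show ?case by (simp add: FS)
  qed
  \<comment> \<open>\<open>C\<close> bounds \<open>f\<close> and is at least \<open>1\<close>, so
    \<open>f v - 1 \<le> (1 - 1 / C) * f v\<close>; this yields the contraction factor
    \<open>r\<close>.\<close>
  define C where "C = 1 + (\<Sum>v\<in>V. f v)"
  define r where "r = 1 - 1 / C"
  have "0 \<le> (\<Sum>v\<in>V. f v)" by (intro sum_nonneg f0)
  then have C: "1 \<le> C" by (simp add: C_def)
  then have r: "0 \<le> r" "r < 1" by (auto simp: r_def)
  have f_le: "f v \<le> C" if "v \<in> V" for v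
    using member_le_sum[OF that, of f] f0 V by (simp add: C_def)
  have Pf_le: "?P f v \<le> r * f v" if "v \<in> V" for v
  proof (cases "v = j")
    case False
    then have "?P f v = f v - 1" using fS[OF that] by (simp add: stopped_step_def)
    moreover have "f v / C \<le> 1" using f_le[OF that] C by simp
    ultimately show ?thesis by (simp add: r_def algebra_simps)
  qed (simp add: stopped_step_def fj)
  have F_le: "F t v \<le> r ^ t * f v" if "v \<in> V" for t v
    using that
  proof (induction t arbitrary: v)
    case (Suc t)
    have "F (Suc t) v \<le> ?P (\<lambda>w. r ^ t * f w) v"
      unfolding FS using Suc by (intro P_mono) auto
    also have "\<dots> \<le> r ^ t * (r * f v)"
      unfolding P_scale using Pf_le[OF Suc.prems] r by (intro mult_left_mono) auto
    finally show ?case by (simp add: algebra_simps)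
  qed (simp add: F_def)
  have P_nonneg: "0 \<le> ?P g v" if "v \<in> V" "\<And>w. w \<in> V \<Longrightarrow> 0 \<le> g w" for g v
    using that N(1)[of v] by (auto simp: stopped_step_def intro!: divide_nonneg_nonneg sum_nonneg)
  have F_nonneg: "0 \<le> F t v" and Q_nonneg: "0 \<le> Q t v" if "v \<in> V" for t v
    using that by (induction t arbitrary: v) (auto simp: F_def Q_def f0 intro!: P_nonneg)
  \<comment> \<open>Summation by parts: \<open>q (s + 1) = Q s - Q (s + 1)\<close> turns the partial
    sum into \<open>\<Sum>s<t. Q s i\<close> minus \<open>t * Q t i\<close>, and the sum of the
    \<open>Q s i\<close> telescopes to \<open>f i - F t i\<close>.\<close>
  have partial: "(\<Sum>s<Suc t. real s * q s i) = f i - (real t * Q t i + F t i)" for t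
  proof (induction t)
    case 0
    then show ?case by (simp add: F_def)
  next
    case (Suc t)
    have "real (Suc t) * q (Suc t) i + real (Suc t) * Q (Suc t) i = real (Suc t) * Q t i"
      using qQ[OF i, of t] by (metis distrib_left)
    then show ?case using Suc QF[OF i, of t] by (simp add: algebra_simps)
  qed
  \<comment> \<open>Here \<open>Q t i \<le> F t i \<le> r ^ t * f i\<close>, and
    \<open>t * r ^ t\<close> tends to zero.\<close>
  have "(\<lambda>t. real t * Q t i + F t i) \<longlonglongrightarrow> 0"
  proof (rule tendsto_sandwich)
    show "\<forall>\<^sub>F t in sequentially. 0 \<le> real t * Q t i + F t i"
      using F_nonneg[OF i] Q_nonneg[OF i] by simp
    show "\<forall>\<^sub>F t in sequentially. real t * Q t i + F t i \<le> (real t * r ^ t + r ^ t) * f i"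
    proof (intro always_eventually allI)
      fix t
      have "Q t i \<le> F t i" using QF[OF i, of t] F_nonneg[OF i, of "Suc t"] by linarith
      then have "real t * Q t i \<le> real t * (r ^ t * f i)"
        using F_le[OF i, of t] by (intro mult_left_mono) auto
      then show "real t * Q t i + F t i \<le> (real t * r ^ t + r ^ t) * f i"
        using F_le[OF i, of t] by (simp add: algebra_simps)
    qed
    have "(\<lambda>t. (real t * r ^ t + r ^ t) * f i) \<longlonglongrightarrow> (0 + 0) * f i"
      using r by (intro tendsto_intros powser_times_n_limit_0 LIMSEQ_power_zero) auto
    then show "(\<lambda>t. (real t * r ^ t + r ^ t) * f i) \<longlonglongrightarrow> 0" by simp
  qed simp
  then have "(\<lambda>t. f i - (real t * Q t i + F t i)) \<longlonglongrightarrow> f i - 0"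
    by (intro tendsto_intros)
  then show ?thesis
    unfolding sums_def by (subst filterlim_sequentially_Suc[symmetric]) (simp only: partial diff_zero)
qed

lemma first_passage_prob_0: "first_passage_prob G v j 0 = (if v = j then 1 else 0)"
  by (simp add: first_passage_prob_def)

text \<open>Condition on the first step: removing the head of the trajectory shifts the passage time
  by one, and for \<open>v = j\<close> passage has already occurred at time 0. The assumptions make
  \<open>pmf_of_set\<close> the uniform law.\<close>

lemma first_passage_prob_Suc:
  assumes "finite {w. (v, w) \<in> parcs G}" "{w. (v, w) \<in> parcs G} \<noteq> {}"
  shows "first_passage_prob G v j (Suc t) =
    stopped_step (\<lambda>v. {w. (v, w) \<in> parcs G}) j (\<lambda>w. first_passage_prob G w j t) v"
proof -
  let ?S = "{xs :: 'a list. xs ! Suc t = j \<and> (\<forall>s<Suc t. xs ! s \<noteq> j)}"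
  have vimage: "(\<lambda>xs. v # xs) -` ?S =
      (if v = j then {} else {xs. xs ! t = j \<and> (\<forall>s<t. xs ! s \<noteq> j)})"
    by (auto simp: All_less_Suc2)
  have "first_passage_prob G v j (Suc t) =
      measure_pmf.expectation (random_step G v)
        (\<lambda>w. measure_pmf.prob (map_pmf (\<lambda>xs. v # xs) (trajectory G t w)) ?S)"
    unfolding first_passage_prob_def trajectory.simps measure_pmf_bind
    by (rule measure_pmf.measure_bind[where N = "count_space UNIV"])
      (auto intro: measure_pmf_in_subprob_algebra)
  also have "\<dots> = stopped_step (\<lambda>v. {w. (v, w) \<in> parcs G}) j (\<lambda>w. first_passage_prob G w j t) v"
    using assms
    by (simp only: measure_map_pmf vimage)
      (simp add: random_step_def integral_pmf_of_set stopped_step_def first_passage_prob_def)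
  finally show ?thesis .
qed

section \<open>Hitting times of a tree\<close>

context tree_metric
begin

lemma branch_card_less:
  assumes "(v, w) \<in> A" shows "card (branch v w) < card V"
proof (rule psubset_card_mono[OF finite_verts])
  have "v \<in> V" using assms arc_verts by blast
  moreover have "v \<notin> branch v w" using dist_self[of v] by (simp add: branch_def)
  ultimately show "branch v w \<subset> V" unfolding branch_def by blast
qed

text \<open>Makes \<open>hitting_time\<close> nonnegative. One step towards \<open>j\<close> lowers
  the total distance by at most \<open>card V - 2\<close>, as a branch at \<open>v\<close> omits
  \<open>v\<close>.\<close>

lemma total_dist_le_add_dist:
  assumes "v \<in> V" "j \<in> V"
  shows "total_dist v \<le> total_dist j + (real (card V) - 1) * d v j"
  using assms(1)
proof (induction "d v j" arbitrary: v rule: less_induct)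
  case less
  show ?case
  proof (cases "v = j")
    case False
    define w where "w = hop v j"
    have w: "(v, w) \<in> A" "d w j + 1 = d v j"
      using hop_arc[OF less(2) assms(2) False] dist_hop[OF less(2) assms(2) False]
      by (auto simp: w_def)
    have "total_dist w \<le> total_dist j + (real (card V) - 1) * d w j"
      using less(1)[of w] w arc_verts by auto
    moreover have "total_dist v \<le> total_dist w + (real (card V) - 1)"
      using total_dist_adjacent[OF w(1)] branch_card_less[OF w(1)] by linarith
    moreover have "real (d v j) = d w j + 1" using w(2) by linarith
    ultimately show ?thesis by (simp add: algebra_simps)
  qed (use assms dist_self in simp)
qed

text \<open>The tree case of \<open>m\<^sub>i\<^sub>j = (\<Sum>k. deg k * (r i j + r j k - r i k)) / 2\<close>, where \<open>r\<close> is the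
  effective resistance, which equals the distance in a tree.\<close>

definition hitting_time :: "'a \<Rightarrow> 'a \<Rightarrow> real" where
  "hitting_time v j = (real (card V) - 1) * d v j + total_dist j - total_dist v"

text \<open>The first-step equation of the walk: the corrections in the neighbour sums of distance
  and total distance add up to \<open>- deg v\<close>.\<close>

lemma hitting_time_step:
  assumes "2 \<le> card V" "v \<in> V" "j \<in> V" "v \<noteq> j"
  shows "hitting_time v j = 1 + (\<Sum>w\<in>neighbours v. hitting_time w j) / card (neighbours v)"
proof -
  have deg: "0 < deg v"
    using neighbours_nonempty[OF assms(1,2)] by (simp add: deg_def card_gt_0_iff)
  have "(\<Sum>w\<in>neighbours v. hitting_time w j) =
      (real (card V) - 1) * (\<Sum>w\<in>neighbours v. real (d w j)) + deg v * total_dist j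
        - (\<Sum>w\<in>neighbours v. total_dist w)"
    by (simp add: hitting_time_def sum.distrib sum_subtractf sum_distrib_left deg_def)
  also have "\<dots> = deg v * hitting_time v j - deg v"
    using assms by (simp add: sum_neighbours_dist_real sum_neighbours_total_dist hitting_time_def
        algebra_simps)
  finally have "(\<Sum>w\<in>neighbours v. hitting_time w j) / deg v = hitting_time v j - 1"
    using deg by (simp add: diff_divide_distrib)
  then show ?thesis by (simp add: deg_def)
qed

definition dist_sum :: real where
  "dist_sum = (\<Sum>v\<in>V. \<Sum>w\<in>V. real (d v w))"

text \<open>The terms with \<open>total_dist i\<close> cancel because the degrees sum to
  \<open>2 * card V - 2\<close>. This is the independence of Kemeny's constant from the starting
  vertex.\<close>

lemma sum_deg_hitting_time:
  assumes i: "i \<in> V"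
  shows "(\<Sum>j\<in>V. deg j * hitting_time i j) =
    2 * dist_sum - (real (card V) - 1) * (2 * real (card V) - 1)"
proof -
  have "(\<Sum>j\<in>V. deg j * total_dist j) = (\<Sum>x\<in>V. \<Sum>j\<in>V. deg j * d j x)"
    by (subst sum.swap) (simp add: total_dist_def sum_distrib_left)
  also have "\<dots> = (\<Sum>x\<in>V. 2 * total_dist x - (real (card V) - 1))"
    by (intro sum.cong refl sum_deg_dist)
  also have "\<dots> = 2 * dist_sum - card V * (real (card V) - 1)"
    by (simp add: sum_subtractf dist_sum_def total_dist_def sum_distrib_left)
  finally have D: "(\<Sum>j\<in>V. deg j * total_dist j) = \<dots>" .
  have d: "(\<Sum>j\<in>V. deg j * d i j) = 2 * total_dist i - (real (card V) - 1)"
    using sum_deg_dist[OF i] by (simp add: dist_commute[OF i] cong: sum.cong)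
  have "(\<Sum>j\<in>V. deg j * hitting_time i j) =
      (real (card V) - 1) * (\<Sum>j\<in>V. deg j * d i j) + (\<Sum>j\<in>V. deg j * total_dist j)
        - (\<Sum>j\<in>V. deg j) * total_dist i"
    by (simp add: hitting_time_def sum_distrib_left sum_distrib_right sum_subtractf
        sum.distrib algebra_simps)
  also have "\<dots> = 2 * dist_sum - (real (card V) - 1) * (2 * real (card V) - 1)"
    unfolding D d sum_deg by (simp add: algebra_simps)
  finally show ?thesis .
qed

end

locale tree_metric_graph = tree_metric "pverts G" "parcs G" d
  for G :: "'a pair_pre_digraph" and d
begin

text \<open>\<open>hitting_time\<close> is nonnegative, vanishes at \<open>j\<close> and solves the
  first-step equation; \<open>hitting_time_sums\<close> identifies any such solution with the
  series.\<close>

lemma mean_first_passage_time_eq: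
  assumes two_verts: "2 \<le> card (pverts G)" and "i \<in> pverts G" "j \<in> pverts G"
  shows "mean_first_passage_time G i j = hitting_time i j"
proof -
  have "(\<lambda>t. real t * first_passage_prob G i j t) sums hitting_time i j"
  proof (rule hitting_time_sums[where N = neighbours and V = "pverts G" and j = j
        and f = "\<lambda>i. hitting_time i j" and q = "\<lambda>t i. first_passage_prob G i j t"])
    show "0 \<le> hitting_time v j" if "v \<in> pverts G" for v
      using total_dist_le_add_dist[OF that assms(3)] by (simp add: hitting_time_def)
    show "first_passage_prob G v j (Suc t) =
        stopped_step neighbours j (\<lambda>i. first_passage_prob G i j t) v" if "v \<in> pverts G" for t v
      using first_passage_prob_Suc[of v G j t] neighbours_nonempty[OF two_verts that]
        finite_neighbours[of v]
      by (simp add: neighbours_def stopped_step_def)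
  qed (use assms hitting_time_step[OF two_verts] neighbours_nonempty[OF two_verts]
      neighbours_subset in
      \<open>auto simp: finite_verts first_passage_prob_0 hitting_time_def dist_self\<close>)
  then show ?thesis by (simp add: mean_first_passage_time_def sums_unique[symmetric])
qed

lemma out_degree_eq: "real (out_degree (with_proj G) v) = deg v"
proof -
  have "out_arcs (with_proj G) v = Pair v ` neighbours v"
    by (auto simp: out_arcs_def neighbours_def)
  then show ?thesis by (simp add: out_degree_def deg_def card_image inj_on_def)
qed

lemma card_arcs: "real (card (parcs G)) = 2 * real (card (pverts G)) - 2"
proof -
  have "parcs G = Sigma (pverts G) neighbours"
    using arcs_subset by (auto simp: neighbours_def)
  then have "card (parcs G) = card (Sigma (pverts G) neighbours)"
    by (rule arg_cong)
  then have "card (parcs G) = (\<Sum>v\<in>pverts G. card (neighbours v))"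
    using finite_verts by simp
  then show ?thesis using sum_deg by (simp add: deg_def)
qed

theorem kemeny_eq:
  assumes two_verts: "2 \<le> card (pverts G)"
  shows "kemeny G = dist_sum / (real (card (pverts G)) - 1) - (2 * real (card (pverts G)) - 1) / 2"
proof -
  define i where "i = (SOME i. i \<in> pverts G)"
  have i: "i \<in> pverts G"
    unfolding i_def using verts_nonempty by (simp add: some_in_eq)
  have "kemeny G = (\<Sum>j\<in>pverts G - {i}. deg j * hitting_time i j) / card (parcs G)"
    unfolding kemeny_def Let_def i_def[symmetric]
    by (simp add: stationary_def out_degree_eq mean_first_passage_time_eq two_verts i sum_divide_distrib)
  also have "(\<Sum>j\<in>pverts G - {i}. deg j * hitting_time i j) =
      (\<Sum>j\<in>pverts G. deg j * hitting_time i j)"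
    using i finite_verts by (simp add: sum.remove hitting_time_def dist_self)
  finally show ?thesis
    using two_verts unfolding sum_deg_hitting_time[OF i] card_arcs
    by (simp add: field_simps)
qed

end

section \<open>Distances and centroids of undirected trees\<close>

text \<open>Pair digraph version of \<open>pre_digraph.del_vert\<close>, to which the reachability
  lemmas of \<open>pair_wf_digraph\<close> apply.\<close>

definition delete_vertex :: "'a pair_pre_digraph \<Rightarrow> 'a \<Rightarrow> 'a pair_pre_digraph" where
  "delete_vertex G v = \<lparr> pverts = pverts G - {v}, parcs = {a \<in> parcs G. fst a \<noteq> v \<and> snd a \<noteq> v} \<rparr>"

lemma delete_vertex_simps [simp]:
  "pverts (delete_vertex G v) = pverts G - {v}"
  "parcs (delete_vertex G v) = {a \<in> parcs G. fst a \<noteq> v \<and> snd a \<noteq> v}"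
  by (simp_all add: delete_vertex_def)

lemma del_vert_with_proj: "pre_digraph.del_vert (with_proj G) v = with_proj (delete_vertex G v)"
  by (simp add: pre_digraph.del_vert_def with_proj_def delete_vertex_def)

lemma pawalk_verts_snoc: "pcas u p v \<Longrightarrow> pawalk_verts u (p @ [(v, w)]) = pawalk_verts u p @ [w]"
  by (induction p arbitrary: u) auto

lemma pcas_snoc: "pcas u p v \<Longrightarrow> pcas u (p @ [(v, w)]) w"
  by (induction p arbitrary: u) auto

text \<open>A path from \<open>a\<close> to \<open>b\<close> avoiding \<open>v\<close>, closed up
  through \<open>v\<close>, would be a cycle with at least three arcs. This is where acyclicity
  enters.\<close>

lemma undirected_tree_branches_disjoint:
  assumes tree: "undirected_tree G"
    and arcs: "(v, a) \<in> parcs G" "(v, b) \<in> parcs G"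
    and reach: "(a, b) \<in> (parcs (delete_vertex G v))\<^sup>*"
  shows "a = b"
proof (rule ccontr)
  assume "a \<noteq> b"
  interpret pair_graph G using tree by (simp add: undirected_tree_def)
  interpret H: pair_wf_digraph "delete_vertex G v"
    by unfold_locales (auto dest: in_arcsD1 in_arcsD2)
  have a: "a \<in> pverts (delete_vertex G v)"
    using arcs(1) no_loops'[of v a] in_arcsD2[OF arcs(1)] by auto
  have "a \<rightarrow>\<^sup>*\<^bsub>with_proj (delete_vertex G v)\<^esub> b"
    using reach a H.reachable_conv'[of a b] by simp
  then obtain p where p: "H.apath a p b" using H.reachable_apath by blast
  then have cas: "pcas a p b" and p_arcs: "set p \<subseteq> parcs G" and dist: "distinct (pawalk_verts a p)"
    by (auto simp: H.apath_def H.awalk_def)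
  have verts: "set (pawalk_verts a p) \<subseteq> pverts (delete_vertex G v)"
    using p H.awalk_verts_in_verts[OF a, of p] by (auto simp: H.apath_def H.awalk_def)
  have "p \<noteq> []" using cas \<open>a \<noteq> b\<close> by auto
  define c where "c = (v, a) # p @ [(b, v)]"
  have "cycle c"
    unfolding cycle_def
  proof (intro exI conjI)
    show "awalk v c v"
      using arcs in_arcsD1[OF arcs(1)] p_arcs arcs_symmetric[OF arcs(2)] pcas_snoc[OF cas]
      by (simp add: awalk_def c_def)
    show "distinct (tl (pawalk_verts v c))"
      using dist verts by (auto simp: c_def pawalk_verts_snoc[OF cas])
  qed (simp add: c_def)
  moreover have "3 \<le> length c" using \<open>p \<noteq> []\<close> by (cases p) (auto simp: c_def)
  ultimately show False using tree by (auto simp: undirected_tree_def)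
qed

section \<open>Graph distance of an undirected tree\<close>

definition graph_dist :: "'a rel \<Rightarrow> 'a \<Rightarrow> 'a \<Rightarrow> nat" where
  "graph_dist A v w = (LEAST n. (v, w) \<in> A ^^ n)"

lemma relpow_sym:
  assumes "sym A" shows "(v, w) \<in> A ^^ n \<Longrightarrow> (w, v) \<in> A ^^ n"
proof (induction n arbitrary: w)
  case (Suc n)
  obtain y where "(v, y) \<in> A ^^ n" "(y, w) \<in> A" using Suc.prems by (rule relpow_Suc_E)
  then show ?case using relpow_Suc_I2[OF symD[OF assms]] Suc.IH by blast
qed simp

lemma undirected_tree_connected:
  assumes tree: "undirected_tree G" and "v \<in> pverts G" "w \<in> pverts G"
  shows "(v, w) \<in> (parcs G)\<^sup>*"
proof -
  interpret pair_graph G using tree by (simp add: undirected_tree_def)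
  have "v \<rightarrow>\<^sup>*\<^bsub>with_proj (mk_symmetric (with_proj G))\<^esub> w"
    using assms by (auto simp: undirected_tree_def connected_def strongly_connected_def)
  then have "v \<rightarrow>\<^sup>*\<^bsub>with_proj G\<^esub> w"
    using reachable_mk_symmetric_eq pair_sym_arcs by blast
  then show ?thesis using reachable_rtranclI by fastforce
qed

text \<open>The second vertex of a shortest walk is a closer neighbour. Two neighbours of
  \<open>v\<close> that are not farther from \<open>x\<close> than \<open>v\<close> is reach
  \<open>x\<close> without meeting \<open>v\<close>, so they coincide by
  \<open>undirected_tree_branches_disjoint\<close>.\<close>

theorem undirected_tree_metric:
  assumes tree: "undirected_tree G"
  shows "tree_metric_graph G (graph_dist (parcs G))"
proof -
  interpret pair_graph G using tree by (simp add: undirected_tree_def)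
  let ?A = "parcs G" and ?d = "graph_dist (parcs G)"
  have sym: "sym ?A" using arcs_symmetric by (auto intro: symI)
  have path: "(v, w) \<in> ?A ^^ ?d v w" if "v \<in> pverts G" "w \<in> pverts G" for v w
    unfolding graph_dist_def
    using undirected_tree_connected[OF tree that] by (auto dest: rtrancl_imp_relpow intro: LeastI_ex)
  have le: "?d v w \<le> n" if "(v, w) \<in> ?A ^^ n" for v w n
    unfolding graph_dist_def using that by (rule Least_le)
  have arc_le: "?d v x \<le> ?d w x + 1" if "(v, w) \<in> ?A" "x \<in> pverts G" for v w x
    using le[OF relpow_Suc_I2[OF that(1) path[OF in_arcsD2[OF that(1)] that(2)]]] by simp
  have step: "\<exists>w. (v, w) \<in> ?A \<and> ?d w x + 1 = ?d v x" if v: "v \<in> pverts G" "x \<in> pverts G" "v \<noteq> x" for v x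
  proof -
    have "?d v x \<noteq> 0"
    proof
      assume "?d v x = 0"
      then show False using path[OF v(1,2)] v(3) by simp
    qed
    then obtain m where m: "?d v x = Suc m" using not0_implies_Suc by blast
    then obtain w where w: "(v, w) \<in> ?A" "(w, x) \<in> ?A ^^ m"
      using path[OF v(1,2)] relpow_Suc_D2[of v x m ?A] by auto
    then show ?thesis using arc_le[OF w(1) v(2)] le[OF w(2)] m by auto
  qed
  \<comment> \<open>After \<open>w\<close>, a shortest walk to \<open>x\<close> visits only vertices
    strictly closer to \<open>x\<close> than \<open>v\<close> is.\<close>
  have avoid: "(w, x) \<in> (parcs (delete_vertex G v))\<^sup>*"
    if "w \<in> pverts G" "x \<in> pverts G" "w \<noteq> v" "?d w x \<le> ?d v x" for v w x
    using that
  proof (induction "?d w x" arbitrary: w rule: less_induct)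
    case less
    show ?case
    proof (cases "w = x")
      case False
      then obtain u where u: "(w, u) \<in> ?A" "?d u x + 1 = ?d w x"
        using step less by blast
      then have "u \<noteq> v" using less by auto
      then have "(u, x) \<in> (parcs (delete_vertex G v))\<^sup>*"
        using less u in_arcsD2[OF u(1)] by simp
      moreover have "(w, u) \<in> parcs (delete_vertex G v)" using u \<open>u \<noteq> v\<close> less by simp
      ultimately show ?thesis by (rule converse_rtrancl_into_rtrancl[rotated])
    qed simp
  qed
  have sym_del: "sym (parcs (delete_vertex G v))" for v
    using sym by (auto intro!: symI dest: symD)
  show ?thesis
    unfolding tree_metric_graph_def
  proof
    show "pverts G \<noteq> {}"
      using tree by (auto simp: undirected_tree_def connected_def strongly_connected_def)
    show "(v, v) \<notin> ?A" for v using no_loops' by blast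
    show "?d v v = 0" if "v \<in> pverts G" for v
      using le[of v v 0] by simp
    show "?d v w = ?d w v" if "v \<in> pverts G" "w \<in> pverts G" for v w
      using le[OF relpow_sym[OF sym path[OF that]]] le[OF relpow_sym[OF sym path[OF that(2,1)]]]
      by simp
    show "\<exists>w. (v, w) \<in> ?A \<and> ?d w x + 1 = ?d v x \<and>
        (\<forall>w'. (v, w') \<in> ?A \<and> w' \<noteq> w \<longrightarrow> ?d w' x = ?d v x + 1)"
      if v: "v \<in> pverts G" "x \<in> pverts G" "v \<noteq> x" for v x
    proof -
      obtain w where w: "(v, w) \<in> ?A" "?d w x + 1 = ?d v x" using step[OF v] by blast
      have "?d w' x = ?d v x + 1" if w': "(v, w') \<in> ?A" "w' \<noteq> w" for w'
      proof (rule ccontr)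
        assume "?d w' x \<noteq> ?d v x + 1"
        then have "?d w' x \<le> ?d v x"
          using arc_le[OF arcs_symmetric[OF w'(1)] v(2)] by simp
        then have "(w', x) \<in> (parcs (delete_vertex G v))\<^sup>*"
          using avoid[of w' x v] w' in_arcsD2 v no_loops' by blast
        moreover have "(w, x) \<in> (parcs (delete_vertex G v))\<^sup>*"
          using avoid[of w x v] w in_arcsD2 v no_loops' by (metis le_add1)
        then have "(x, w) \<in> (parcs (delete_vertex G v))\<^sup>*"
          using sym_rtrancl[OF sym_del] by (auto dest: symD)
        ultimately have "(w', w) \<in> (parcs (delete_vertex G v))\<^sup>*" by simp
        then show False using undirected_tree_branches_disjoint[OF tree w'(1) w(1)] w' by simp
      qed
      then show ?thesis using w by blast
    qed
  qed (use in_arcsD1 in_arcsD2 arcs_symmetric pair_finite_verts in auto)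
qed

section \<open>Centroids as minimisers of the total distance\<close>

context tree_metric_graph
begin

text \<open>The path from a vertex of the branch to \<open>w\<close> avoids \<open>v\<close> and
  stays in the branch, which is therefore connected; it is maximal since arcs off \<open>v\<close>
  cannot leave it.\<close>

lemma branch_in_sccs_verts:
  assumes vw: "(v, w) \<in> parcs G"
  shows "branch v w \<in> pre_digraph.sccs_verts (with_proj (delete_vertex G v))"
proof -
  let ?H = "delete_vertex G v"
  interpret H: pair_wf_digraph ?H
    by unfold_locales (use arcs_subset in auto)
  have w: "w \<in> branch v w"
    using arc_verts[OF vw] dist_adjacent[OF vw] dist_self by (simp add: branch_def)
  have not_v: "v \<notin> branch v w" using mem_branch_iff[OF vw] by blast
  have reach: "x \<rightarrow>\<^sup>*\<^bsub>with_proj ?H\<^esub> w \<and> w \<rightarrow>\<^sup>*\<^bsub>with_proj ?H\<^esub> x" if "x \<in> branch v w" for x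
    using that
  proof (induction "d x w" arbitrary: x rule: less_induct)
    case less
    have x: "x \<in> pverts G" "x \<noteq> v" "w \<in> pverts G"
      using less(2) mem_branch_iff[OF vw] arc_verts[OF vw] by auto
    show ?case
    proof (cases "x = w")
      case True
      then show ?thesis using x by simp
    next
      case False
      define e where "e = hop x w"
      have e: "(x, e) \<in> parcs G" "d e w + 1 = d x w"
        using hop_arc[OF x(1,3) False] dist_hop[OF x(1,3) False] by (auto simp: e_def)
      \<comment> \<open>Passing through \<open>v\<close> would put \<open>x\<close> at distance 2
        from \<open>w\<close> but 1 from \<open>v\<close>, so outside the branch.\<close>
      have "e \<noteq> v"
      proof
        assume "e = v"
        then have "d x w = 2" using e dist_adjacent[OF vw] by simp
        moreover have "d v x = 1"
          using dist_adjacent arcs_sym[OF e(1)] \<open>e = v\<close> by simp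
        moreover have "d w x = d x w" using x dist_commute by blast
        ultimately show False using less(2) by (simp add: branch_def)
      qed
      then have arcs: "(x, e) \<in> parcs ?H" "(e, x) \<in> parcs ?H"
        using e x arcs_sym by auto
      have "e \<in> branch v w" using arc_in_branch[OF vw e(1) \<open>e \<noteq> v\<close> less(2)] .
      then have "e \<rightarrow>\<^sup>*\<^bsub>with_proj ?H\<^esub> w" "w \<rightarrow>\<^sup>*\<^bsub>with_proj ?H\<^esub> e"
        using less(1) e(2) by auto
      then show ?thesis
        using arcs H.adj_reachable_trans[of x e w] H.reachable_adj_trans[of w e x] by simp
    qed
  qed
  have closed: "y \<in> branch v w" if "x \<rightarrow>\<^sup>*\<^bsub>with_proj ?H\<^esub> y" "x \<in> branch v w" for x y
    using that
  proof (induction rule: H.reachable_induct)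
    case (step y z)
    then show ?case using arc_in_branch[OF vw, of y z] by auto
  qed
  show ?thesis
    unfolding H.sccs_verts_def
  proof (intro CollectI conjI ballI allI impI)
    show "branch v w \<noteq> {}" using w by blast
    show "x \<rightarrow>\<^sup>*\<^bsub>with_proj ?H\<^esub> y" if "x \<in> branch v w" "y \<in> branch v w" for x y
      using reach that H.reachable_trans by blast
  qed (use closed in blast)
qed

text \<open>Any \<open>x\<close> in \<open>C\<close> selects the branch of \<open>hop v x\<close>,
  which walks avoiding \<open>v\<close> cannot leave. Inclusion is enough, since a centroid only
  bounds cardinalities from above.\<close>

lemma sccs_verts_subset_branch:
  assumes v: "v \<in> pverts G"
    and C: "C \<in> pre_digraph.sccs_verts (with_proj (delete_vertex G v))"
  shows "\<exists>w. (v, w) \<in> parcs G \<and> C \<subseteq> branch v w"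
proof -
  let ?H = "delete_vertex G v"
  interpret H: pair_wf_digraph ?H
    by unfold_locales (use arcs_subset in auto)
  obtain x where x: "x \<in> C" using C by (auto simp: H.sccs_verts_def)
  have reach: "x \<rightarrow>\<^sup>*\<^bsub>with_proj ?H\<^esub> y" if "y \<in> C" for y
    using C x that by (auto simp: H.sccs_verts_def)
  then have xV: "x \<in> pverts G" "x \<noteq> v" using H.reachable_in_verts(1)[OF reach[OF x]] by auto
  define w where "w = hop v x"
  have w: "(v, w) \<in> parcs G" using hop_arc[OF v xV(1)] xV(2) by (auto simp: w_def)
  have "y \<in> branch v w" if "x \<rightarrow>\<^sup>*\<^bsub>with_proj ?H\<^esub> y" for y
    using that
  proof (induction rule: H.reachable_induct)
    case base
    then show ?case using xV mem_branch_iff[OF w] by (simp add: w_def)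
  next
    case (step y z)
    then show ?case using arc_in_branch[OF w, of y z] by auto
  qed
  then show ?thesis using reach w by blast
qed

text \<open>Both sides bound the branches at \<open>v\<close> by half of the vertices, the left one
  through the components that remain without \<open>v\<close>.\<close>

theorem centroid_iff_total_dist_minimal:
  "centroid G v \<longleftrightarrow> v \<in> pverts G \<and> (\<forall>x\<in>pverts G. total_dist v \<le> total_dist x)"
proof (cases "v \<in> pverts G")
  case True
  have "(\<forall>C\<in>pre_digraph.sccs_verts (with_proj (delete_vertex G v)). card C \<le> card (pverts G) div 2) \<longleftrightarrow>
      (\<forall>w. (v, w) \<in> parcs G \<longrightarrow> card (branch v w) \<le> card (pverts G) div 2)" (is "?L \<longleftrightarrow> ?R")
  proof
    assume ?L
    then show ?R using branch_in_sccs_verts by blast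
  next
    assume R: ?R
    show ?L
    proof
      fix C assume "C \<in> pre_digraph.sccs_verts (with_proj (delete_vertex G v))"
      then obtain w where w: "(v, w) \<in> parcs G" "C \<subseteq> branch v w"
        using sccs_verts_subset_branch[OF True] by blast
      have "finite (branch v w)" using finite_verts by (simp add: branch_def)
      then have "card C \<le> card (branch v w)" using w(2) by (rule card_mono)
      then show "card C \<le> card (pverts G) div 2" using R w(1) by fastforce
    qed
  qed
  then show ?thesis
    using True total_dist_minimal_iff_branches[OF True]
    by (simp add: centroid_def del_vert_with_proj)
qed (simp add: centroid_def)

end

section \<open>Chains of trees\<close>

lemma sum_sum_subset_diff:
  fixes f :: "'a \<Rightarrow> 'a \<Rightarrow> real"
  assumes "finite W" "B \<subseteq> W" and sym: "\<And>x y. x \<in> W \<Longrightarrow> y \<in> W \<Longrightarrow> f x y = f y x"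
  shows "(\<Sum>x\<in>W. \<Sum>y\<in>W. f x y) = (\<Sum>x\<in>B. \<Sum>y\<in>B. f x y) +
    2 * (\<Sum>x\<in>W - B. \<Sum>y\<in>B. f x y) + (\<Sum>x\<in>W - B. \<Sum>y\<in>W - B. f x y)"
proof -
  have "(\<Sum>x\<in>B. \<Sum>y\<in>W - B. f x y) = (\<Sum>x\<in>W - B. \<Sum>y\<in>B. f x y)"
    by (subst sum.swap, intro sum.cong refl) (use assms in auto)
  then show ?thesis
    by (simp add: sum.subset_diff[OF assms(2,1)] sum.distrib)
qed

locale chain_parts = base: tree_metric_graph T dT
  for T :: "nat pair_pre_digraph" and dT +
  fixes Gs :: "nat \<Rightarrow> 'a pair_pre_digraph" and d :: "nat \<Rightarrow> 'a \<Rightarrow> 'a \<Rightarrow> nat"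
  assumes parts: "i \<in> pverts T \<Longrightarrow> tree_metric_graph (Gs i) (d i)"
    and disjoint: "disjoint_family_on (\<lambda>i. pverts (Gs i)) (pverts T)"
    and two_parts: "2 \<le> card (pverts T)"
begin

definition verts_union :: "'a set" where
  "verts_union = (\<Union>i\<in>pverts T. pverts (Gs i))"

definition part :: "'a \<Rightarrow> nat" where
  "part x = (THE i. i \<in> pverts T \<and> x \<in> pverts (Gs i))"

text \<open>The vertex of \<open>Gs l\<close> through which every path from \<open>x\<close> into \<open>Gs l\<close> enters.\<close>

definition proj :: "(nat \<Rightarrow> nat \<Rightarrow> 'a) \<Rightarrow> nat \<Rightarrow> 'a \<Rightarrow> 'a" where
  "proj c l x = (if part x = l then x else c l (base.hop l (part x)))"

text \<open>A part off the path from \<open>x\<close> to \<open>y\<close> contributes \<open>0\<close>, as both project to the same vertex.\<close>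

definition chain_dist :: "(nat \<Rightarrow> nat \<Rightarrow> 'a) \<Rightarrow> 'a \<Rightarrow> 'a \<Rightarrow> nat" where
  "chain_dist c x y = dT (part x) (part y) + (\<Sum>l\<in>pverts T. d l (proj c l x) (proj c l y))"

lemma part_eq: "i \<in> pverts T \<Longrightarrow> x \<in> pverts (Gs i) \<Longrightarrow> part x = i"
  unfolding part_def using disjoint by (intro the_equality) (auto simp: disjoint_family_on_def)

lemma part_in: "x \<in> verts_union \<Longrightarrow> part x \<in> pverts T \<and> x \<in> pverts (Gs (part x))"
  using part_eq by (fastforce simp: verts_union_def)

lemma part_subset: "i \<in> pverts T \<Longrightarrow> pverts (Gs i) \<subseteq> verts_union"
  by (auto simp: verts_union_def)

lemma finite_verts_union: "finite verts_union"
  unfolding verts_union_def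
proof (intro finite_UN_I base.finite_verts)
  fix i assume "i \<in> pverts T"
  then interpret tree_metric_graph "Gs i" "d i" by (rule parts)
  show "finite (pverts (Gs i))" by (rule finite_verts)
qed

lemma part_verts_nonempty: "i \<in> pverts T \<Longrightarrow> pverts (Gs i) \<noteq> {}"
  using parts unfolding tree_metric_graph_def tree_metric_def by blast

lemma verts_union_card: "2 \<le> card verts_union"
proof -
  have "part ` verts_union = pverts T"
    using part_in part_subset part_eq part_verts_nonempty by (force simp: image_iff)
  then have "card (pverts T) \<le> card verts_union"
    using card_image_le[OF finite_verts_union, of part] by simp
  then show ?thesis using two_parts by linarith
qed

lemma attachment_in: "attachment T Gs c \<Longrightarrow> (i, j) \<in> parcs T \<Longrightarrow> c i j \<in> pverts (Gs i)"
  by (auto simp: attachment_def)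

lemma attachment_part: "attachment T Gs c \<Longrightarrow> (i, j) \<in> parcs T \<Longrightarrow> part (c i j) = i"
  using attachment_in base.arc_verts part_eq by blast

lemma proj_in:
  assumes "attachment T Gs c" "l \<in> pverts T" "x \<in> verts_union"
  shows "proj c l x \<in> pverts (Gs l)"
  using assms part_in[OF assms(3)] base.hop_arc[of l "part x"] attachment_in
  by (auto simp: proj_def)

text \<open>If \<open>l\<close> is \<open>i\<close> or \<open>t\<close>, both ends project to the
  end lying in \<open>Gs l\<close>; otherwise \<open>hop_arc_cong\<close> in \<open>T\<close>
  applies. Crossing a bridge thus changes only the \<open>dT\<close> term of
  \<open>chain_dist\<close>.\<close>

lemma proj_bridge:
  assumes c: "attachment T Gs c" and it: "(i, t) \<in> parcs T" and l: "l \<in> pverts T"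
  shows "proj c l (c t i) = proj c l (c i t)"
proof -
  have ti: "(t, i) \<in> parcs T" using it base.arcs_sym by blast
  have neq: "i \<noteq> t" using it base.arcs_irrefl by blast
  note p = attachment_part[OF c it] attachment_part[OF c ti]
  show ?thesis
    using base.hop_arc_cong[OF it l] base.hop_adjacent[OF it] base.hop_adjacent[OF ti] p neq
    by (auto simp: proj_def)
qed

text \<open>An arc inside \<open>Gs i\<close> changes no projection to another part, so only the
  summand \<open>l = i\<close> differs. The additive form avoids subtraction of naturals.\<close>

lemma chain_dist_part_arc:
  assumes "i \<in> pverts T" "(u, w) \<in> parcs (Gs i)" "z \<in> verts_union"
  shows "chain_dist c w z + d i u (proj c i z) = chain_dist c u z + d i w (proj c i z)"
proof -
  interpret tree_metric_graph "Gs i" "d i" using assms(1) by (rule parts)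
  have p: "part u = i" "part w = i"
    using arc_verts[OF assms(2)] part_eq[OF assms(1)] by auto
  have "(\<Sum>l\<in>pverts T - {i}. d l (proj c l w) (proj c l z)) =
      (\<Sum>l\<in>pverts T - {i}. d l (proj c l u) (proj c l z))"
    by (intro sum.cong refl) (auto simp: proj_def p)
  moreover have "proj c i u = u" "proj c i w = w" by (simp_all add: proj_def p)
  ultimately show ?thesis
    using sum.remove[OF base.finite_verts assms(1), of "\<lambda>l. d l (proj c l u) (proj c l z)"]
      sum.remove[OF base.finite_verts assms(1), of "\<lambda>l. d l (proj c l w) (proj c l z)"]
    by (simp add: chain_dist_def p)
qed

lemma chain_dist_bridge:
  assumes "attachment T Gs c" "(i, t) \<in> parcs T"
  shows "chain_dist c (c t i) z + dT i (part z) = chain_dist c (c i t) z + dT t (part z)"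
  using proj_bridge[OF assms] attachment_part[OF assms] attachment_part[OF assms(1) base.arcs_sym[OF assms(2)]]
  by (simp add: chain_dist_def cong: sum.cong)

lemma chain_verts [simp]: "pverts (chain_graph T Gs c) = verts_union"
  by (simp add: chain_graph_def verts_union_def)

lemma chain_arc_cases:
  assumes c: "attachment T Gs c" and "(u, w) \<in> parcs (chain_graph T Gs c)"
  obtains (inner) "part u \<in> pverts T" "(u, w) \<in> parcs (Gs (part u))"
    | (bridge) t where "(part u, t) \<in> parcs T" "u = c (part u) t" "w = c t (part u)"
proof -
  from assms(2) consider i where "i \<in> pverts T" "(u, w) \<in> parcs (Gs i)"
    | i t where "(i, t) \<in> parcs T" "u = c i t" "w = c t i"
    by (auto simp: chain_graph_def)
  then show thesis
  proof cases
    case 1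
    interpret tree_metric_graph "Gs i" "d i" using 1(1) by (rule parts)
    have "part u = i" using arc_verts 1 part_eq by blast
    then show thesis using 1 inner by blast
  next
    case 2
    then show thesis using bridge[of t] attachment_part[OF c] by simp
  qed
qed

lemma chain_inner_arc: "i \<in> pverts T \<Longrightarrow> (u, w) \<in> parcs (Gs i) \<Longrightarrow> (u, w) \<in> parcs (chain_graph T Gs c)"
  by (auto simp: chain_graph_def)

lemma chain_bridge_arc: "(i, t) \<in> parcs T \<Longrightarrow> (c i t, c t i) \<in> parcs (chain_graph T Gs c)"
  by (force simp: chain_graph_def)

text \<open>Let \<open>a\<close> be the projection of \<open>z\<close> to the part of
  \<open>u\<close>. The closer neighbour of \<open>u\<close> is the next vertex towards
  \<open>a\<close> inside the part if \<open>u \<noteq> a\<close>, and otherwise the far end of the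
  bridge towards the part of \<open>z\<close>. Every other arc leads away.\<close>

theorem chain_tree_metric:
  assumes c: "attachment T Gs c"
  shows "tree_metric_graph (chain_graph T Gs c) (chain_dist c)"
  unfolding tree_metric_graph_def
proof
  let ?G = "chain_graph T Gs c"
  show "finite (pverts ?G)" by (simp add: finite_verts_union)
  show "pverts ?G \<noteq> {}" using verts_union_card by auto
  have arc: "w \<in> verts_union \<and> (w, u) \<in> parcs ?G \<and> u \<in> verts_union \<and> u \<noteq> w" if "(u, w) \<in> parcs ?G" for u w
    using c that
  proof (cases rule: chain_arc_cases)
    case inner
    interpret tree_metric_graph "Gs (part u)" "d (part u)" using inner(1) by (rule parts)
    show ?thesis
      using arc_verts[OF inner(2)] arcs_sym[OF inner(2)] arcs_irrefl inner(2)
        part_subset[OF inner(1)] chain_inner_arc[OF inner(1)] by blast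
  next
    case (bridge t)
    have tu: "(t, part u) \<in> parcs T" using bridge base.arcs_sym by blast
    show ?thesis
      using chain_bridge_arc[OF tu, of c] attachment_in[OF c tu] attachment_in[OF c bridge(1)]
        attachment_part[OF c tu] base.arc_verts[OF tu] part_subset bridge base.arcs_irrefl tu
      by (metis subsetD)
  qed
  show "parcs ?G \<subseteq> pverts ?G \<times> pverts ?G" using arc by auto
  show "(v, w) \<in> parcs ?G \<Longrightarrow> (w, v) \<in> parcs ?G" for v w using arc by blast
  show "(v, v) \<notin> parcs ?G" for v using arc by blast
  show "chain_dist c v v = 0" if "v \<in> pverts ?G" for v
  proof -
    have "d l (proj c l v) (proj c l v) = 0" if "l \<in> pverts T" for l
    proof -
      interpret tree_metric_graph "Gs l" "d l" using that by (rule parts)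
      show ?thesis using proj_in[OF c that] \<open>v \<in> pverts ?G\<close> dist_self by simp
    qed
    then show ?thesis using that part_in base.dist_self by (simp add: chain_dist_def)
  qed
  show "chain_dist c v w = chain_dist c w v" if "v \<in> pverts ?G" "w \<in> pverts ?G" for v w
  proof -
    have "d l (proj c l v) (proj c l w) = d l (proj c l w) (proj c l v)" if "l \<in> pverts T" for l
    proof -
      interpret tree_metric_graph "Gs l" "d l" using that by (rule parts)
      show ?thesis
        using proj_in[OF c that] \<open>v \<in> pverts ?G\<close> \<open>w \<in> pverts ?G\<close> dist_commute by simp
    qed
    then show ?thesis
      using that part_in base.dist_commute[of "part v" "part w"] by (simp add: chain_dist_def)
  qed
  show "\<exists>w. (u, w) \<in> parcs ?G \<and> chain_dist c w z + 1 = chain_dist c u z \<and>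
      (\<forall>w'. (u, w') \<in> parcs ?G \<and> w' \<noteq> w \<longrightarrow> chain_dist c w' z = chain_dist c u z + 1)"
    if uz: "u \<in> pverts ?G" "z \<in> pverts ?G" "u \<noteq> z" for u z
  proof -
    define i j a where "i = part u" and "j = part z" and "a = proj c i z"
    have i: "i \<in> pverts T" "u \<in> pverts (Gs i)" and j: "j \<in> pverts T"
      using part_in uz by (auto simp: i_def j_def)
    have z: "z \<in> verts_union" using uz by simp
    interpret P: tree_metric_graph "Gs i" "d i" using i(1) by (rule parts)
    have a: "a \<in> pverts (Gs i)" using proj_in[OF c i(1) z] by (simp add: a_def)
    note inner_dist = chain_dist_part_arc[OF i(1) _ z, of u _ c, folded a_def]
    note bridge_dist = chain_dist_bridge[OF c, of i _ z, folded j_def]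
    \<comment> \<open>Only the bridge towards part \<open>j\<close> decreases \<open>dT\<close>; for
      \<open>i = j\<close> no bridge does.\<close>
    have away: "dT t j = dT i j + 1" if "(i, t) \<in> parcs T" "i = j \<or> t \<noteq> base.hop i j" for t
      using that base.dist_not_hop[OF i(1) j] base.dist_adjacent[OF base.arcs_sym[OF that(1)]]
        base.dist_self[OF j] by (cases "i = j") auto
    show ?thesis
    proof (cases "u = a")
      case False
      define w where "w = P.hop u a"
      have w: "(u, w) \<in> parcs (Gs i)" "d i w a + 1 = d i u a"
        using P.hop_arc[OF i(2) a False] P.dist_hop[OF i(2) a False] by (auto simp: w_def)
      have "chain_dist c w' z = chain_dist c u z + 1" if w': "(u, w') \<in> parcs ?G" "w' \<noteq> w" for w'
        using c w'(1)
      proof (cases rule: chain_arc_cases)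
        case inner
        then show ?thesis
          using inner_dist[of w'] P.dist_not_hop[OF i(2) a False, of w'] w' by (simp add: i_def w_def)
      next
        case (bridge t)
        then have t: "(i, t) \<in> parcs T" "u = c i t" "w' = c t i" by (simp_all add: i_def)
        \<comment> \<open>If \<open>t\<close> were the next part towards \<open>j\<close>, then
          \<open>u = c i t\<close> would be the entry vertex \<open>a\<close>.\<close>
        have "i = j \<or> t \<noteq> base.hop i j"
          using False t(2) by (auto simp: a_def proj_def j_def)
        then show ?thesis using away[OF t(1)] bridge_dist[OF t(1)] t by simp
      qed
      moreover have "chain_dist c w z + 1 = chain_dist c u z"
        using inner_dist[OF w(1)] w(2) by linarith
      ultimately show ?thesis using chain_inner_arc[OF i(1) w(1)] by blast
    next
      case True
      then have ij: "i \<noteq> j" using uz(3) by (auto simp: a_def proj_def j_def)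
      define t where "t = base.hop i j"
      have t: "(i, t) \<in> parcs T" "dT t j + 1 = dT i j"
        using base.hop_arc[OF i(1) j ij] base.dist_hop[OF i(1) j ij] by (auto simp: t_def)
      have u: "u = c i t" using True ij by (simp add: a_def proj_def j_def t_def)
      have "chain_dist c w' z = chain_dist c u z + 1"
        if w': "(u, w') \<in> parcs ?G" "w' \<noteq> c t i" for w'
        using c w'(1)
      proof (cases rule: chain_arc_cases)
        case inner
        then have "(u, w') \<in> parcs (Gs i)" by (simp add: i_def)
        then show ?thesis
          using inner_dist[of w'] P.dist_adjacent[OF P.arcs_sym, of u w'] P.dist_self[OF i(2)] True
          by simp
      next
        case (bridge s)
        then have s: "(i, s) \<in> parcs T" "u = c i s" "w' = c s i" by (simp_all add: i_def)
        \<comment> \<open>Several bridges may start at \<open>u\<close>, so they are told apart by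
          their far ends.\<close>
        then have "s \<noteq> t" using w'(2) by auto
        then show ?thesis using away[OF s(1)] bridge_dist[OF s(1)] s by (simp add: t_def)
      qed
      moreover have "chain_dist c (c t i) z + 1 = chain_dist c u z"
        using bridge_dist[OF t(1)] t(2) u by simp
      ultimately show ?thesis using chain_bridge_arc[OF t(1), of c] u by blast
    qed
  qed
qed

section \<open>Splitting the distance sum over the parts\<close>

abbreviation part_total_dist :: "nat \<Rightarrow> 'a \<Rightarrow> real" where
  "part_total_dist l \<equiv> tree_metric.total_dist (pverts (Gs l)) (d l)"

definition min_total_dist :: "nat \<Rightarrow> real" where
  "min_total_dist l = Min (part_total_dist l ` pverts (Gs l))"

definition outside :: "nat \<Rightarrow> 'a set" where
  "outside l = verts_union - pverts (Gs l)"

text \<open>The share of \<open>Gs l\<close> in the distance sum that depends on \<open>c\<close>,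
  with the minimal total distance subtracted so that its least value is zero. Mixed pairs occur in
  both orders, hence the factor 2.\<close>

definition excess :: "(nat \<Rightarrow> nat \<Rightarrow> 'a) \<Rightarrow> nat \<Rightarrow> real" where
  "excess c l = 2 * (\<Sum>x\<in>outside l. part_total_dist l (proj c l x) - min_total_dist l) +
    (\<Sum>x\<in>outside l. \<Sum>y\<in>outside l. real (d l (proj c l x) (proj c l y)))"

text \<open>The share of the distance sum common to all attachments.\<close>

definition base_dist_sum :: real where
  "base_dist_sum = (\<Sum>x\<in>verts_union. \<Sum>y\<in>verts_union. real (dT (part x) (part y))) +
    (\<Sum>l\<in>pverts T. (\<Sum>x\<in>pverts (Gs l). \<Sum>y\<in>pverts (Gs l). real (d l x y)) +
      2 * real (card (outside l)) * min_total_dist l)"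

lemma finite_outside [simp]: "finite (outside l)"
  using finite_verts_union by (simp add: outside_def)

lemma min_total_dist_le:
  assumes "l \<in> pverts T" "v \<in> pverts (Gs l)"
  shows "min_total_dist l \<le> part_total_dist l v"
proof -
  interpret tree_metric_graph "Gs l" "d l" using assms(1) by (rule parts)
  show ?thesis using assms(2) finite_verts by (simp add: min_total_dist_def)
qed

text \<open>Vertices of \<open>Gs l\<close> project to themselves and outer ones to bridge ends, so
  the pairs mixing both kinds give total distances of bridge ends.\<close>

lemma proj_dist_sum:
  assumes c: "attachment T Gs c" and l: "l \<in> pverts T"
  shows "(\<Sum>x\<in>verts_union. \<Sum>y\<in>verts_union. real (d l (proj c l x) (proj c l y))) =
    (\<Sum>x\<in>pverts (Gs l). \<Sum>y\<in>pverts (Gs l). real (d l x y)) +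
      2 * real (card (outside l)) * min_total_dist l + excess c l"
proof -
  interpret P: tree_metric_graph "Gs l" "d l" using l by (rule parts)
  have proj_self: "proj c l x = x" if "x \<in> pverts (Gs l)" for x
    using part_eq[OF l that] by (simp add: proj_def)
  have "(\<Sum>x\<in>verts_union. \<Sum>y\<in>verts_union. real (d l (proj c l x) (proj c l y))) =
      (\<Sum>x\<in>pverts (Gs l). \<Sum>y\<in>pverts (Gs l). real (d l (proj c l x) (proj c l y))) +
      2 * (\<Sum>x\<in>outside l. \<Sum>y\<in>pverts (Gs l). real (d l (proj c l x) (proj c l y))) +
      (\<Sum>x\<in>outside l. \<Sum>y\<in>outside l. real (d l (proj c l x) (proj c l y)))"
    unfolding outside_def
    by (intro sum_sum_subset_diff finite_verts_union part_subset[OF l])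
      (simp add: P.dist_commute proj_in[OF c l])
  also have "\<dots> = (\<Sum>x\<in>pverts (Gs l). \<Sum>y\<in>pverts (Gs l). real (d l x y)) +
      2 * (\<Sum>x\<in>outside l. P.total_dist (proj c l x)) +
      (\<Sum>x\<in>outside l. \<Sum>y\<in>outside l. real (d l (proj c l x) (proj c l y)))"
    by (simp add: proj_self P.total_dist_def cong: sum.cong)
  finally show ?thesis by (simp add: excess_def sum_subtractf algebra_simps)
qed

text \<open>All chains have the same vertices, so by \<open>kemeny_eq\<close> comparing Kemeny's
  constants amounts to comparing sums of excesses.\<close>

lemma kemeny_chain:
  assumes c: "attachment T Gs c"
  shows "kemeny (chain_graph T Gs c) =
    (base_dist_sum + (\<Sum>l\<in>pverts T. excess c l)) / (real (card verts_union) - 1)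
      - (2 * real (card verts_union) - 1) / 2"
proof -
  interpret G: tree_metric_graph "chain_graph T Gs c" "chain_dist c"
    using c by (rule chain_tree_metric)
  have "G.dist_sum = (\<Sum>x\<in>verts_union. \<Sum>y\<in>verts_union. real (dT (part x) (part y))) +
      (\<Sum>x\<in>verts_union. \<Sum>y\<in>verts_union. \<Sum>l\<in>pverts T. real (d l (proj c l x) (proj c l y)))"
    by (subst G.dist_sum_def) (simp add: chain_dist_def sum.distrib)
  also have "(\<Sum>x\<in>verts_union. \<Sum>y\<in>verts_union. \<Sum>l\<in>pverts T. real (d l (proj c l x) (proj c l y))) =
      (\<Sum>x\<in>verts_union. \<Sum>l\<in>pverts T. \<Sum>y\<in>verts_union. real (d l (proj c l x) (proj c l y)))"
    by (intro sum.cong refl sum.swap)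
  also have "\<dots> = (\<Sum>l\<in>pverts T. \<Sum>x\<in>verts_union. \<Sum>y\<in>verts_union. real (d l (proj c l x) (proj c l y)))"
    by (rule sum.swap)
  finally have "G.dist_sum = base_dist_sum + (\<Sum>l\<in>pverts T. excess c l)"
    by (simp add: base_dist_sum_def proj_dist_sum[OF c] sum.distrib)
  then show ?thesis using G.kemeny_eq verts_union_card by simp
qed

lemma excess_nonneg:
  assumes c: "attachment T Gs c" and l: "l \<in> pverts T"
  shows "0 \<le> excess c l"
  unfolding excess_def
  using min_total_dist_le[OF l] proj_in[OF c l]
  by (intro add_nonneg_nonneg mult_nonneg_nonneg sum_nonneg) (auto simp: outside_def)

text \<open>Each neighbour \<open>t\<close> contributes, since \<open>Gs t\<close> has a vertex and
  all its vertices enter \<open>Gs l\<close> at \<open>c l t\<close>. Hence every bridge end has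
  positive weight in \<open>excess\<close>.\<close>

lemma proj_outside:
  assumes l: "l \<in> pverts T"
  shows "proj c l ` outside l = c l ` base.neighbours l"
proof (intro equalityI subsetI)
  fix y assume "y \<in> proj c l ` outside l"
  then obtain x where x: "x \<in> outside l" "y = proj c l x" by blast
  then have "part x \<in> pverts T" "part x \<noteq> l"
    using part_in[of x] by (auto simp: outside_def)
  then show "y \<in> c l ` base.neighbours l"
    using x base.hop_arc[OF l, of "part x"] by (auto simp: proj_def base.neighbours_def)
next
  fix y assume "y \<in> c l ` base.neighbours l"
  then obtain t where t: "(l, t) \<in> parcs T" "y = c l t" by (auto simp: base.neighbours_def)
  have tT: "t \<in> pverts T" and "t \<noteq> l" using t base.arc_verts base.arcs_irrefl by auto
  obtain x where x: "x \<in> pverts (Gs t)" using part_verts_nonempty[OF tT] by blast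
  have "part x = t" using part_eq[OF tT x] .
  then have "proj c l x = y" using \<open>t \<noteq> l\<close> t base.hop_adjacent[OF t(1)] by (simp add: proj_def)
  moreover have "x \<in> outside l"
    using x part_subset[OF tT] part_eq[OF l, of x] \<open>part x = t\<close> \<open>t \<noteq> l\<close> by (auto simp: outside_def)
  ultimately show "y \<in> proj c l ` outside l" by blast
qed

text \<open>Both sums in \<open>excess\<close> have nonnegative terms. The first vanishes iff all
  entry vertices minimise the total distance, that is, are centroids; the second iff they
  coincide.\<close>

lemma excess_eq_0_iff:
  assumes c: "attachment T Gs c" and l: "l \<in> pverts T"
  shows "excess c l = 0 \<longleftrightarrow>
    (\<forall>t\<in>base.neighbours l. centroid (Gs l) (c l t)) \<and> is_singleton (c l ` base.neighbours l)"
proof -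
  interpret P: tree_metric_graph "Gs l" "d l" using l by (rule parts)
  have p: "proj c l x \<in> pverts (Gs l)" if "x \<in> outside l" for x
    using proj_in[OF c l] that by (simp add: outside_def)
  have centroid: "part_total_dist l v = min_total_dist l \<longleftrightarrow> centroid (Gs l) v"
    if v: "v \<in> pverts (Gs l)" for v
  proof -
    have "part_total_dist l v = min_total_dist l \<longleftrightarrow> part_total_dist l v \<le> min_total_dist l"
      using min_total_dist_le[OF l v] by linarith
    also have "\<dots> \<longleftrightarrow> (\<forall>x\<in>pverts (Gs l). part_total_dist l v \<le> part_total_dist l x)"
      using P.finite_verts P.verts_nonempty by (simp add: min_total_dist_def)
    finally show ?thesis using P.centroid_iff_total_dist_minimal v by simp
  qed
  have "excess c l = 0 \<longleftrightarrow>
      (\<Sum>x\<in>outside l. part_total_dist l (proj c l x) - min_total_dist l) = 0 \<and>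
      (\<Sum>x\<in>outside l. \<Sum>y\<in>outside l. real (d l (proj c l x) (proj c l y))) = 0"
  proof -
    have "0 \<le> (\<Sum>x\<in>outside l. part_total_dist l (proj c l x) - min_total_dist l)"
      using min_total_dist_le[OF l p] by (intro sum_nonneg) simp
    moreover have "0 \<le> (\<Sum>x\<in>outside l. \<Sum>y\<in>outside l. real (d l (proj c l x) (proj c l y)))"
      by (intro sum_nonneg) simp
    ultimately show ?thesis unfolding excess_def by linarith
  qed
  also have "(\<Sum>x\<in>outside l. part_total_dist l (proj c l x) - min_total_dist l) = 0 \<longleftrightarrow>
      (\<forall>x\<in>outside l. centroid (Gs l) (proj c l x))"
    using min_total_dist_le[OF l p] centroid[OF p] by (subst sum_nonneg_eq_0_iff) auto
  also have "\<dots> \<longleftrightarrow> (\<forall>v\<in>proj c l ` outside l. centroid (Gs l) v)" by blast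
  also have "(\<Sum>x\<in>outside l. \<Sum>y\<in>outside l. real (d l (proj c l x) (proj c l y))) = 0 \<longleftrightarrow>
      (\<forall>x\<in>outside l. \<forall>y\<in>outside l. proj c l x = proj c l y)"
    using P.dist_eq_0_iff[OF p p]
    by (simp add: sum_nonneg_eq_0_iff sum_nonneg)
  also have "\<dots> \<longleftrightarrow> (\<forall>v\<in>proj c l ` outside l. \<forall>w\<in>proj c l ` outside l. v = w)" by simp
  also have "\<dots> \<longleftrightarrow> is_singleton (proj c l ` outside l)"
  proof -
    have "proj c l ` outside l \<noteq> {}"
      unfolding proj_outside[OF l] using base.neighbours_nonempty[OF two_parts l] by simp
    then show ?thesis by (metis is_singletonI' is_singletonE singletonD)
  qed
  finally show ?thesis unfolding proj_outside[OF l] by blast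
qed

text \<open>Attaching all bridges of each part to one of its centroids makes every excess zero at
  once. The minimal sum is therefore zero, and a zero sum of nonnegative excesses has only zero
  terms.\<close>

theorem is_arg_min_kemeny_iff:
  assumes c: "attachment T Gs c"
  shows "is_arg_min kemeny (is_chain T Gs) (chain_graph T Gs c) \<longleftrightarrow>
    (\<forall>l\<in>pverts T. excess c l = 0)"
proof -
  have "\<exists>v. centroid (Gs l) v" if l: "l \<in> pverts T" for l
  proof -
    interpret P: tree_metric_graph "Gs l" "d l" using l by (rule parts)
    obtain v where "is_arg_min P.total_dist (\<lambda>v. v \<in> pverts (Gs l)) v"
      using ex_is_arg_min_if_finite[OF P.finite_verts P.verts_nonempty] by blast
    then show ?thesis
      using P.centroid_iff_total_dist_minimal by (auto simp: is_arg_min_linorder)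
  qed
  then obtain z where z: "\<And>l. l \<in> pverts T \<Longrightarrow> centroid (Gs l) (z l)" by metis
  define c' where "c' l t = z l" for l t :: nat
  have c': "attachment T Gs c'"
    using z base.arc_verts by (auto simp: attachment_def c'_def centroid_def)
  have "c' l ` base.neighbours l = {z l}" if "l \<in> pverts T" for l
    using base.neighbours_nonempty[OF two_parts that] by (auto simp: c'_def)
  then have c'0: "excess c' l = 0" if "l \<in> pverts T" for l
    using that z by (simp add: excess_eq_0_iff[OF c' that]) (simp add: c'_def)
  have n: "0 < real (card verts_union) - 1" using verts_union_card by simp
  have le_iff: "kemeny (chain_graph T Gs c1) \<le> kemeny (chain_graph T Gs c2) \<longleftrightarrow>
      (\<Sum>l\<in>pverts T. excess c1 l) \<le> (\<Sum>l\<in>pverts T. excess c2 l)"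
    if "attachment T Gs c1" "attachment T Gs c2" for c1 c2
    using n by (simp add: kemeny_chain that divide_le_cancel)
  have "is_arg_min kemeny (is_chain T Gs) (chain_graph T Gs c) \<longleftrightarrow>
      (\<forall>c2. attachment T Gs c2 \<longrightarrow> kemeny (chain_graph T Gs c) \<le> kemeny (chain_graph T Gs c2))"
    using c by (auto simp: is_arg_min_linorder is_chain_def)
  also have "\<dots> \<longleftrightarrow> (\<forall>c2. attachment T Gs c2 \<longrightarrow>
      (\<Sum>l\<in>pverts T. excess c l) \<le> (\<Sum>l\<in>pverts T. excess c2 l))"
    using le_iff[OF c] by blast
  also have "\<dots> \<longleftrightarrow> (\<Sum>l\<in>pverts T. excess c l) = 0"
  proof
    assume "\<forall>c2. attachment T Gs c2 \<longrightarrow> (\<Sum>l\<in>pverts T. excess c l) \<le> (\<Sum>l\<in>pverts T. excess c2 l)"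
    then have "(\<Sum>l\<in>pverts T. excess c l) \<le> 0" using c' c'0 by fastforce
    moreover have "0 \<le> (\<Sum>l\<in>pverts T. excess c l)" by (intro sum_nonneg excess_nonneg[OF c])
    ultimately show "(\<Sum>l\<in>pverts T. excess c l) = 0" by simp
  qed (simp add: sum_nonneg excess_nonneg)
  also have "\<dots> \<longleftrightarrow> (\<forall>l\<in>pverts T. excess c l = 0)"
    using excess_nonneg[OF c] base.finite_verts by (simp add: sum_nonneg_eq_0_iff)
  finally show ?thesis .
qed

section \<open>Bridges and their ends\<close>

lemma bridges_chain:
  assumes c: "attachment T Gs c"
  shows "bridges T Gs (chain_graph T Gs c) = (\<lambda>(i, j). (c i j, c j i)) ` parcs T"
proof -
  \<comment> \<open>The ends of an added edge lie in different parts, so removing the arcs of the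
    parts removes no added arc.\<close>
  have "(c i j, c j i) \<notin> parcs (Gs l)" if ij: "(i, j) \<in> parcs T" and l: "l \<in> pverts T" for i j l
  proof
    interpret P: tree_metric_graph "Gs l" "d l" using l by (rule parts)
    assume "(c i j, c j i) \<in> parcs (Gs l)"
    then have "part (c i j) = l" "part (c j i) = l" using P.arc_verts part_eq[OF l] by auto
    then have "i = j" using attachment_part[OF c] ij base.arcs_sym by metis
    then show False using ij base.arcs_irrefl by blast
  qed
  then show ?thesis by (auto simp: bridges_def chain_graph_def)
qed

lemma bridge_ends:
  assumes c: "attachment T Gs c" and i: "i \<in> pverts T"
  shows "{v \<in> pverts (Gs i). \<exists>w. (v, w) \<in> bridges T Gs (chain_graph T Gs c)} =
    c i ` base.neighbours i"
proof -
  have "i' = i" if "c i' j \<in> pverts (Gs i)" "(i', j) \<in> parcs T" for i' j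
    using part_eq[OF i that(1)] attachment_part[OF c that(2)] by simp
  then show ?thesis
    unfolding bridges_chain[OF c] using attachment_in[OF c] by (force simp: base.neighbours_def)
qed

end

theorem proposition3p17:
  fixes k :: nat
    and T :: "nat pair_pre_digraph"
    and Gs :: "nat \<Rightarrow> 'a pair_pre_digraph"
    and G :: "'a pair_pre_digraph"
  assumes "k \<ge> 2"
    and "undirected_tree T" and "pverts T = {1..k}"
    and "\<And>i. i \<in> {1..k} \<Longrightarrow> undirected_tree (Gs i)"
    and "disjoint_family_on (\<lambda>i. pverts (Gs i)) {1..k}"
    and "is_chain T Gs G"
  shows "is_arg_min kemeny (is_chain T Gs) G \<longleftrightarrow>
    (\<forall>(x, y) \<in> bridges T Gs G. centroid (part_of T Gs x) x \<and> centroid (part_of T Gs y) y) \<and>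
    (\<forall>i \<in> {1..k}. is_singleton {v \<in> pverts (Gs i). \<exists>w. (v, w) \<in> bridges T Gs G})"
proof -
  interpret base: tree_metric_graph T "graph_dist (parcs T)"
    using assms(2) by (rule undirected_tree_metric)
  interpret chain_parts T "graph_dist (parcs T)" Gs "\<lambda>i. graph_dist (parcs (Gs i))"
    using assms undirected_tree_metric base.tree_metric_graph_axioms
    by (intro chain_parts.intro chain_parts_axioms.intro) auto
  obtain c where c: "attachment T Gs c" and G: "G = chain_graph T Gs c"
    using assms(6) by (auto simp: is_chain_def)
  have part_of: "part_of T Gs (c i j) = Gs i" if "(i, j) \<in> parcs T" for i j
    using attachment_part[OF c that] by (simp add: part_of_def part_def)
  have "(\<forall>(x, y) \<in> bridges T Gs G. centroid (part_of T Gs x) x \<and> centroid (part_of T Gs y) y) \<longleftrightarrow>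
      (\<forall>(i, j) \<in> parcs T. centroid (Gs i) (c i j) \<and> centroid (Gs j) (c j i))"
    unfolding G bridges_chain[OF c] using part_of base.arcs_sym by fastforce
  \<comment> \<open>Arcs of \<open>T\<close> come in both orientations, so the condition on both
    ends reduces to the first ends, grouped by part.\<close>
  also have "\<dots> \<longleftrightarrow> (\<forall>i\<in>pverts T. \<forall>j\<in>base.neighbours i. centroid (Gs i) (c i j))"
    using base.arcs_sym base.arc_verts by (auto simp: base.neighbours_def)
  finally show ?thesis
    unfolding G is_arg_min_kemeny_iff[OF c] assms(3)[symmetric]
    using excess_eq_0_iff[OF c] bridge_ends[OF c] by auto
qed

end
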